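(* Consider the planar Newtonian three-body problem with three equal masses $m_1=m_2=m_3=1$, and let $G=D_3$ (order $6$) with generators $h_1,h_2$ act by $\sigma(h_1)=(1\,2)$, $\sigma(h_2)=(2\,3)$, and with both $\rho(h_1)$ and $\rho(h_2)$ equal to the rotation of angle $\pi$ in the plane. Assume that all local minima of $\mathcal{A}^G$ in $\Lambda^G$ are collision-free. Then $\mathcal{A}^G$ attains its minimum on $\Lambda^G$, and a minimizer is a collision-free $T$-periodic solution which is a choreography and is not homographic (it is neither an Euler nor a Lagrange solution).
   Context: Let $T>0$, $T^1=\mathbb{R}/T\mathbb{Z}$, $\mathcal{X}=\{x\in(\mathbb{R}^2)^3:x_1+x_2+x_3=0\}$, $\Lambda=H^1(T^1,\mathcal{X})$. The generators act on time by $h_1t=-t$ and $h_2t=\frac T3-t$; $\rho\colon G\to O(2)$ is the action on the plane and $\sigma\colon G\to\Sigma_3$ the action on the indices. $G$ acts on $\mathcal{X}$ by $(gx)_i=\rho(g)x_{\sigma(g)^{-1}(i)}$ and on $\Lambda$ by $(g\cdot x)(t)=g\,x(g^{-1}t)$; $\Lambda^G$ is the set of loops fixed by $G$. $\mathcal{A}(x)=\int_0^T\big(\sum_i\frac12|\dot x_i|^2+\sum_{i<j}\frac1{|x_i-x_j|}\big)dt$, $\mathcal{A}^G=\mathcal{A}|_{\Lambda^G}$. A loop is collision-free if $x_i(t)\neq x_j(t)$ for all $t$ and $i\ne j$. A solution is a solution of Newton's equations. It is a choreography if the bodies follow one and the same closed curve with equal time shifts, i.e. up to relabeling the bodies $x_{i+1}(t)=x_i(t+T/3)$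 (indices mod $3$). It is homographic if, identifying the plane with $\mathbb{C}$, $x(t)=s(t)x(0)$ for a $\mathbb{C}$-valued function $s$. *)

theory Defs
  imports
    "HOL-Analysis.Analysis"
    "HOL-Algebra.Group_Action"
    "HOL-Algebra.Generated_Groups"
    "HOL-Combinatorics.Transposition"
    "HOL-Library.Periodic_Fun"
    "HOL-Library.Real_Mod"
begin

text \<open>
  A configuration is a vector \<^term>\<open>x :: real^2^3\<close> whose component \<^term>\<open>x $ i\<close> is the position of
  body \<^term>\<open>i\<close>. Indices live in the type \<^typ>\<open>3\<close>, where \<^term>\<open>3 = (0 :: 3)\<close> and addition is
  modulo 3. Loops on \<open>\<real>/T\<int>\<close> are \<open>T\<close>-periodic functions on \<open>\<real>\<close>.
\<close>

type_synonym configuration = "real^2^3"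
type_synonym loop = "real \<Rightarrow> configuration"

definition config_space :: "configuration set" where
  "config_space = {x. x $ 1 + x $ 2 + x $ 3 = 0}"


subsection \<open>The loop space\<close>

text \<open>Weak derivative on the circle: integration by parts against \<open>C\<^sup>1\<close> periodic test functions.\<close>

definition has_weak_derivative :: "real \<Rightarrow> loop \<Rightarrow> loop \<Rightarrow> bool" where
  "has_weak_derivative T x v \<longleftrightarrow>
     set_borel_measurable lborel {0..T} v \<and>
     set_integrable lborel {0..T} (\<lambda>t. (norm (v t))\<^sup>2) \<and>
     (\<forall>\<phi> \<phi>' :: real \<Rightarrow> real.
        periodic_fun_simple \<phi> T \<and> continuous_on UNIV \<phi>' \<and>
        (\<forall>t. (\<phi> has_real_derivative \<phi>' t) (at t)) \<longrightarrow>
        (LBINT t:{0..T}. \<phi>' t *\<^sub>R x t) = - (LBINT t:{0..T}. \<phi> t *\<^sub>R v t))"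

text \<open>Determined up to a null set; only used under integrals over \<open>[0, T]\<close>.\<close>

definition weak_derivative :: "real \<Rightarrow> loop \<Rightarrow> loop" where
  "weak_derivative T x = (SOME v. has_weak_derivative T x v)"

text \<open>\<open>H\<^sup>1(\<real>/T\<int>, \<X>)\<close>, each class being represented by its continuous representative.\<close>

definition loop_space :: "real \<Rightarrow> loop set" where
  "loop_space T = {x. periodic_fun_simple x T \<and> continuous_on UNIV x \<and>
     (\<forall>t. x t \<in> config_space) \<and> (\<exists>v. has_weak_derivative T x v)}"

definition H1_norm :: "real \<Rightarrow> loop \<Rightarrow> real" where
  "H1_norm T x =
     sqrt (LBINT t:{0..T}. (norm (x t))\<^sup>2 + (norm (weak_derivative T x t))\<^sup>2)"


subsection \<open>Group actions\<close>

definition D3_generated_by :: "('g, 'm) monoid_scheme \<Rightarrow> 'g \<Rightarrow> 'g \<Rightarrow> bool" where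
  "D3_generated_by G h\<^sub>1 h\<^sub>2 \<longleftrightarrow>
     group G \<and> order G = 6 \<and> h\<^sub>1 \<in> carrier G \<and> h\<^sub>2 \<in> carrier G \<and>
     generate G {h\<^sub>1, h\<^sub>2} = carrier G \<and>
     h\<^sub>1 \<otimes>\<^bsub>G\<^esub> h\<^sub>1 = \<one>\<^bsub>G\<^esub> \<and> h\<^sub>2 \<otimes>\<^bsub>G\<^esub> h\<^sub>2 = \<one>\<^bsub>G\<^esub> \<and>
     (h\<^sub>1 \<otimes>\<^bsub>G\<^esub> h\<^sub>2) [^]\<^bsub>G\<^esub> (3::nat) = \<one>\<^bsub>G\<^esub>"

definition orthogonal_group :: "(real^'n^'n) monoid" where
  "orthogonal_group = \<lparr>carrier = {A. orthogonal_matrix A}, mult = (**), one = mat 1\<rparr>"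

definition plane_rotation :: "real \<Rightarrow> real^2^2" where
  "plane_rotation \<theta> = vector [vector [cos \<theta>, - sin \<theta>], vector [sin \<theta>, cos \<theta>]]"

text \<open>\<open>(g x)\<^sub>i = \<rho>(g) x\<^bsub>\<sigma>(g)\<^sup>-\<^sup>1(i)\<^esub>\<close>\<close>

definition config_action ::
  "('g \<Rightarrow> real^2^2) \<Rightarrow> ('g \<Rightarrow> 3 \<Rightarrow> 3) \<Rightarrow> 'g \<Rightarrow> configuration \<Rightarrow> configuration" where
  "config_action \<rho> \<sigma> g x = (\<chi> i. \<rho> g *v (x $ inv_into UNIV (\<sigma> g) i))"

text \<open>The circle \<open>\<real>/T\<int>\<close> is modelled by the representatives \<open>{0..<T}\<close>, on which \<open>\<tau>\<close> acts.\<close>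

definition loop_action ::
  "real \<Rightarrow> ('g, 'm) monoid_scheme \<Rightarrow> ('g \<Rightarrow> real \<Rightarrow> real) \<Rightarrow> ('g \<Rightarrow> real^2^2) \<Rightarrow> ('g \<Rightarrow> 3 \<Rightarrow> 3)
     \<Rightarrow> 'g \<Rightarrow> loop \<Rightarrow> loop" where
  "loop_action T G \<tau> \<rho> \<sigma> g x = (\<lambda>t. config_action \<rho> \<sigma> g (x (\<tau> (inv\<^bsub>G\<^esub> g) (t rmod T))))"

definition fixed_loops ::
  "real \<Rightarrow> ('g, 'm) monoid_scheme \<Rightarrow> ('g \<Rightarrow> real \<Rightarrow> real) \<Rightarrow> ('g \<Rightarrow> real^2^2) \<Rightarrow> ('g \<Rightarrow> 3 \<Rightarrow> 3)
     \<Rightarrow> loop set" where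
  "fixed_loops T G \<tau> \<rho> \<sigma> = {x \<in> loop_space T. \<forall>g\<in>carrier G. loop_action T G \<tau> \<rho> \<sigma> g x = x}"


subsection \<open>The action functional and its minima\<close>

text \<open>Extended-valued: in \<^typ>\<open>ennreal\<close> a vanishing distance contributes \<open>1 / 0 = \<infinity>\<close>.\<close>

definition action :: "real \<Rightarrow> loop \<Rightarrow> ennreal" where
  "action T x = (\<integral>\<^sup>+t\<in>{0..T}.
     (ennreal (\<Sum>i\<in>UNIV. 1/2 * (norm (weak_derivative T x t $ i))\<^sup>2) +
      (\<Sum>(i, j)\<in>{(i, j). i < j}. 1 / ennreal (norm (x t $ i - x t $ j)))) \<partial>lborel)"

definition minimizer_on :: "('a \<Rightarrow> ennreal) \<Rightarrow> 'a set \<Rightarrow> 'a \<Rightarrow> bool" where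
  "minimizer_on A S x \<longleftrightarrow> x \<in> S \<and> (\<forall>y\<in>S. A x \<le> A y)"

definition H1_local_minimizer_on :: "real \<Rightarrow> (loop \<Rightarrow> ennreal) \<Rightarrow> loop set \<Rightarrow> loop \<Rightarrow> bool" where
  "H1_local_minimizer_on T A S x \<longleftrightarrow>
     x \<in> S \<and> (\<exists>\<epsilon>>0. \<forall>y\<in>S. H1_norm T (\<lambda>t. y t - x t) < \<epsilon> \<longrightarrow> A x \<le> A y)"


subsection \<open>Types of loops\<close>

definition collision_free :: "loop \<Rightarrow> bool" where
  "collision_free x \<longleftrightarrow> (\<forall>t i j. i \<noteq> j \<longrightarrow> x t $ i \<noteq> x t $ j)"

text \<open>Only meaningful for collision-free \<open>x\<close>, since \<open>1 / 0 = 0\<close> in \<^typ>\<open>real\<close>.\<close>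

definition newton_solution :: "loop \<Rightarrow> bool" where
  "newton_solution x \<longleftrightarrow>
     (\<exists>v. (\<forall>t. (x has_vector_derivative v t) (at t)) \<and>
          (\<forall>t i. ((\<lambda>s. v s $ i) has_vector_derivative
             (\<Sum>j\<in>UNIV - {i}. (1 / norm (x t $ j - x t $ i) ^ 3) *\<^sub>R (x t $ j - x t $ i))) (at t)))"

definition choreography :: "real \<Rightarrow> loop \<Rightarrow> bool" where
  "choreography T x \<longleftrightarrow> periodic_fun_simple x T \<and>
     (\<exists>\<pi> :: 3 \<Rightarrow> 3. bij \<pi> \<and> (\<forall>i t. x t $ \<pi> (i + 1) = x (t + T / 3) $ \<pi> i))"

definition to_complex :: "real^2 \<Rightarrow> complex" where
  "to_complex p = Complex (p $ 1) (p $ 2)"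

definition homographic :: "loop \<Rightarrow> bool" where
  "homographic x \<longleftrightarrow>
     (\<exists>s :: real \<Rightarrow> complex. \<forall>t i. to_complex (x t $ i) = s t * to_complex (x 0 $ i))"

definition euler_solution :: "loop \<Rightarrow> bool" where
  "euler_solution x \<longleftrightarrow> collision_free x \<and> newton_solution x \<and> homographic x \<and>
     (\<forall>t. collinear {x t $ 1, x t $ 2, x t $ 3})"

definition lagrange_solution :: "loop \<Rightarrow> bool" where
  "lagrange_solution x \<longleftrightarrow> collision_free x \<and> newton_solution x \<and> homographic x \<and>
     (\<forall>t. dist (x t $ 1) (x t $ 2) = dist (x t $ 2) (x t $ 3) \<and>
          dist (x t $ 2) (x t $ 3) = dist (x t $ 3) (x t $ 1))"

end

theory Submission
  imports Defs "HOL-Complex_Analysis.Great_Picard"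
begin

text \<open>
  The symmetric loops are \<open>(q(t + T/3), q(t + 2T/3), q(t))\<close> with \<open>q\<close> odd; so they are choreographies, and
  since \<open>x\<^sub>3(0) = 0\<close> a homographic one vanishes identically and has collisions.

  A minimizer exists by the direct method. Oddness bounds a minimizing sequence, Arzela-Ascoli gives a
  uniform limit, Fatou's lemma handles the potential and a parallelogram argument the kinetic energy.
  By assumption a minimizer \<open>x\<close> is collision-free. Let \<open>y\<close> be the symmetric periodic solution of \<open>y'' = F(x)\<close>,
  with \<open>F\<close> the Newtonian force. The first variation of the action in the symmetric direction \<open>x - y\<close> is
  the squared \<open>L\<^sup>2\<close> norm of \<open>x' - y'\<close>. As it vanishes, \<open>x - y\<close> is constant and \<open>x'' = F(x)\<close>.
\<close>

subsection \<open>Square integrable functions\<close>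

text \<open>A minimizer \<open>x\<close> is only known to be of class H1, so Newton's equation
  cannot be tested on it pointwise. The comparison loop \<open>y\<close> bypasses this: along a
  collision-free loop the force is continuous, so \<open>y\<close> is C2, and the force commutes
  with the symmetries, so \<open>y\<close> can be chosen in the symmetric class and
  \<open>x - y\<close> is an admissible direction. Oddness gives every component of the force mean
  zero over a period, which is the solvability condition for a periodic \<open>y\<close>. Finiteness
  of the minimum comes out at the end rather than entering at the start. If the infimum is infinite,
  every symmetric loop is a minimizer and the assumption on local minima applies to it; a minimizer
  known to be collision-free has finite action, and this lets the variation be computed in the
  reals. Since \<open>weak_derivative\<close> is an arbitrary choice, uniqueness almost everywhere
  and the recovery of a loop from its weak derivative come early; they also supply the modulus of
  continuity behind the compactness argument.\<close>

definition square_integrable :: "'a measure \<Rightarrow> ('a \<Rightarrow> 'b::euclidean_space) \<Rightarrow> bool" where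
  "square_integrable M f \<longleftrightarrow> f \<in> borel_measurable M \<and> integrable M (\<lambda>x. (norm (f x))\<^sup>2)"

lemma square_integrable_norm_sq: "square_integrable M f \<Longrightarrow> integrable M (\<lambda>x. (norm (f x))\<^sup>2)"
  by (simp add: square_integrable_def)

lemma norm_add_sq_le: "(norm (a + b))\<^sup>2 \<le> 2 * (norm a)\<^sup>2 + 2 * (norm b)\<^sup>2"
  for a b :: "'a::real_inner"
proof -
  have "0 \<le> (norm (a - b))\<^sup>2" by simp
  then show ?thesis
    by (simp add: power2_norm_eq_inner inner_diff inner_add inner_commute)
qed

lemma square_integrable_add:
  assumes "square_integrable M f" "square_integrable M g"
  shows "square_integrable M (\<lambda>x. f x + g x)"
proof -
  have [measurable]: "f \<in> borel_measurable M" "g \<in> borel_measurable M"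
    using assms by (auto simp: square_integrable_def)
  have "integrable M (\<lambda>x. 2 * (norm (f x))\<^sup>2 + 2 * (norm (g x))\<^sup>2)"
    using assms by (auto simp: square_integrable_def)
  then have "integrable M (\<lambda>x. (norm (f x + g x))\<^sup>2)"
    by (rule Bochner_Integration.integrable_bound) (auto intro!: AE_I2 norm_add_sq_le)
  then show ?thesis by (simp add: square_integrable_def)
qed

lemma square_integrable_scaleR:
  assumes "square_integrable M f"
  shows "square_integrable M (\<lambda>x. c *\<^sub>R f x)"
  using assms by (auto simp: square_integrable_def power_mult_distrib)

lemma square_integrable_diff:
  assumes "square_integrable M f" "square_integrable M g"
  shows "square_integrable M (\<lambda>x. f x - g x)"
  using square_integrable_add[OF assms(1) square_integrable_scaleR[OF assms(2), of "-1"]] by simp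

lemma square_integrable_inner:
  assumes "square_integrable M f" "square_integrable M g"
  shows "integrable M (\<lambda>x. f x \<bullet> g x)"
proof -
  have [measurable]: "f \<in> borel_measurable M" "g \<in> borel_measurable M"
    using assms by (auto simp: square_integrable_def)
  have "integrable M (\<lambda>x. (norm (f x))\<^sup>2 + (norm (g x))\<^sup>2)"
    using assms by (auto simp: square_integrable_def)
  then show ?thesis
  proof (rule Bochner_Integration.integrable_bound)
    have "\<bar>a \<bullet> b\<bar> \<le> (norm a)\<^sup>2 + (norm b)\<^sup>2" for a b :: 'b
    proof -
      have "\<bar>a \<bullet> b\<bar> \<le> norm a * norm b" by (rule Cauchy_Schwarz_ineq2)
      moreover have "0 \<le> norm a * norm b" by simp
      ultimately show ?thesis using sum_squares_bound[of "norm a" "norm b"] by linarith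
    qed
    then show "AE x in M. norm (f x \<bullet> g x) \<le> norm ((norm (f x))\<^sup>2 + (norm (g x))\<^sup>2)"
      by (auto intro!: AE_I2)
  qed measurable
qed

lemma (in finite_measure) square_integrable_integrable:
  assumes "square_integrable M f"
  shows "integrable M f"
proof -
  have [measurable]: "f \<in> borel_measurable M" using assms by (auto simp: square_integrable_def)
  have "integrable M (\<lambda>x. 1 + (norm (f x))\<^sup>2)"
    using assms by (auto simp: square_integrable_def)
  then show ?thesis
  proof (rule Bochner_Integration.integrable_bound)
    have "a \<le> 1 + a\<^sup>2" for a :: real
      using zero_le_power2[of "a - 1/2"] by (simp add: power2_eq_square algebra_simps)
    then show "AE x in M. norm (f x) \<le> norm (1 + (norm (f x))\<^sup>2)"
      by (auto intro!: AE_I2)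
  qed measurable
qed

lemma integrable_bounded_scaleR:
  fixes f :: "'a \<Rightarrow> 'b::euclidean_space" and h :: "'a \<Rightarrow> real"
  assumes "integrable M f" "h \<in> borel_measurable M" "\<And>x. x \<in> space M \<Longrightarrow> \<bar>h x\<bar> \<le> C"
  shows "integrable M (\<lambda>x. h x *\<^sub>R f x)"
proof -
  have [measurable]: "f \<in> borel_measurable M" "h \<in> borel_measurable M" using assms by auto
  have "integrable M (\<lambda>x. C *\<^sub>R f x)" using assms by auto
  then show ?thesis
  proof (rule Bochner_Integration.integrable_bound)
    show "AE x in M. norm (h x *\<^sub>R f x) \<le> norm (C *\<^sub>R f x)"
      using assms(3) by (intro AE_I2) (auto intro!: mult_right_mono order_trans[OF assms(3) abs_ge_self])
  qed measurable
qed

text \<open>Cauchy-Schwarz against the constant 1. The integral of the square of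
  \<open>norm (f x) - c\<close> is a nonnegative quadratic polynomial in \<open>c\<close>; its value
  at the mean \<open>c = ?I / ?m\<close> is the claim. Total mass zero is split off because the mean
  is then undefined.\<close>

lemma (in finite_measure) integral_norm_sq_le:
  assumes "square_integrable M f"
  shows "(\<integral>x. norm (f x) \<partial>M)\<^sup>2 \<le> measure M (space M) * (\<integral>x. (norm (f x))\<^sup>2 \<partial>M)"
proof -
  let ?m = "measure M (space M)" and ?I = "\<integral>x. norm (f x) \<partial>M" and ?J = "\<integral>x. (norm (f x))\<^sup>2 \<partial>M"
  have i: "integrable M (\<lambda>x. norm (f x))" "integrable M (\<lambda>x. (norm (f x))\<^sup>2)"
    using square_integrable_integrable[OF assms] assms by (auto simp: square_integrable_def)
  have q: "0 \<le> ?J - 2 * c * ?I + c\<^sup>2 * ?m" for c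
  proof -
    have "0 \<le> (\<integral>x. (norm (f x) - c)\<^sup>2 \<partial>M)" by (rule integral_nonneg_AE) auto
    also have "(\<lambda>x. (norm (f x) - c)\<^sup>2) = (\<lambda>x. (norm (f x))\<^sup>2 - 2 * c * norm (f x) + c\<^sup>2)"
      by (auto simp: power2_eq_square algebra_simps)
    also have "(\<integral>x. (norm (f x))\<^sup>2 - 2 * c * norm (f x) + c\<^sup>2 \<partial>M) = ?J - 2 * c * ?I + c\<^sup>2 * ?m"
      using i by simp
    finally show ?thesis .
  qed
  show ?thesis
  proof (cases "?m = 0")
    case True
    then have "AE x in M. False"
      by (simp add: AE_iff_measurable[OF sets.top] emeasure_eq_measure)
    then have "?I = 0" by (intro integral_eq_zero_AE) auto
    then show ?thesis using True by simp
  next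
    case False
    then have m: "?m > 0" by (simp add: zero_less_measure_iff)
    have "0 \<le> ?m * (?J - 2 * (?I / ?m) * ?I + (?I / ?m)\<^sup>2 * ?m)"
      using q[of "?I / ?m"] m by (intro mult_nonneg_nonneg) auto
    also have "\<dots> = ?m * ?J - ?I\<^sup>2" using m by (simp add: field_simps power2_eq_square)
    finally show ?thesis by simp
  qed
qed

text \<open>The Riesz-Fischer theorem. A fast subsequence has increments with summable L1 norms, so
  it converges almost everywhere; Fatou's lemma then turns the Cauchy estimate into convergence of
  the whole sequence to that pointwise limit.\<close>

lemma (in finite_measure) square_integrable_complete:
  fixes v :: "nat \<Rightarrow> 'a \<Rightarrow> 'b::euclidean_space"
  assumes v: "\<And>n. square_integrable M (v n)"
    and cauchy: "\<And>e. e > 0 \<Longrightarrow> \<exists>N. \<forall>m\<ge>N. \<forall>n\<ge>N. (\<integral>x. (norm (v m x - v n x))\<^sup>2 \<partial>M) < e"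
  obtains w where "square_integrable M w" "(\<lambda>n. \<integral>x. (norm (v n x - w x))\<^sup>2 \<partial>M) \<longlonglongrightarrow> 0"
proof -
  have [measurable]: "v n \<in> borel_measurable M" for n
    using v by (auto simp: square_integrable_def)
  have "\<exists>N. \<forall>j. \<forall>m\<ge>N j. \<forall>n\<ge>N j. (\<integral>x. (norm (v m x - v n x))\<^sup>2 \<partial>M) < (1/4)^j"
    by (rule choice) (use cauchy in auto)
  then obtain N where N: "\<And>j m n. m \<ge> N j \<Longrightarrow> n \<ge> N j \<Longrightarrow> (\<integral>x. (norm (v m x - v n x))\<^sup>2 \<partial>M) < (1/4)^j"
    by blast
  \<comment> \<open>The sum dominates every \<open>N i\<close> with \<open>i \<le> j\<close>, so all
    later terms of the subsequence obey all earlier Cauchy bounds.\<close>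
  define k where "k j = j + (\<Sum>i\<le>j. N i)" for j
  have k_ge: "k j \<ge> N i" if "i \<le> j" for i j
    using member_le_sum[of i "{..j}" N] that unfolding k_def by auto
  have sqd: "square_integrable M (\<lambda>x. v m x - v n x)" for m n
    by (intro square_integrable_diff v)
  define d where "d j x = v (k (Suc j)) x - v (k j) x" for j x
  have [measurable]: "d j \<in> borel_measurable M" for j unfolding d_def by measurable
  have d_sq: "square_integrable M (d j)" for j unfolding d_def by (rule sqd)
  have d_int: "integrable M (d j)" for j by (rule square_integrable_integrable[OF d_sq])
  define \<mu> where "\<mu> = measure M (space M)"
  have \<mu>0: "\<mu> \<ge> 0" by (simp add: \<mu>_def)
  have d_le: "(\<integral>x. norm (d j x) \<partial>M) \<le> (\<mu> + 1) * (1/2)^j" for j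
  proof -
    have "(\<integral>x. norm (d j x) \<partial>M)\<^sup>2 \<le> \<mu> * (\<integral>x. (norm (d j x))\<^sup>2 \<partial>M)"
      unfolding \<mu>_def by (rule integral_norm_sq_le[OF d_sq])
    also have "\<dots> \<le> \<mu> * (1/4)^j"
      using N[of j "k (Suc j)" "k j"] k_ge[of j "Suc j"] k_ge[of j j] \<mu>0
      unfolding d_def by (intro mult_left_mono) auto
    \<comment> \<open>Replacing \<open>\<mu>\<close> by the larger
      \<open>(\<mu> + 1)\<^sup>2\<close> makes the bound a perfect square, so the root can be taken
      for any total mass.\<close>
    also have "\<dots> \<le> (\<mu> + 1)\<^sup>2 * (1/4)^j"
      using \<mu>0 by (intro mult_right_mono) (auto simp: power2_eq_square algebra_simps)
    also have "\<dots> = ((\<mu> + 1) * (1/2)^j)\<^sup>2"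
      by (simp add: power_mult_distrib power2_eq_square power_divide flip: power_mult_distrib)
    finally show ?thesis by (rule power2_le_imp_le) (use \<mu>0 in simp)
  qed
  have summ: "summable (\<lambda>j. \<integral>x. norm (d j x) \<partial>M)"
    by (rule summable_comparison_test'[where g = "\<lambda>j. (\<mu> + 1) * (1/2)^j" and N = 0])
       (use d_le in \<open>auto intro!: summable_mult summable_geometric\<close>)
  have "(\<integral>\<^sup>+x. (\<Sum>j. ennreal (norm (d j x))) \<partial>M) = (\<Sum>j. \<integral>\<^sup>+x. ennreal (norm (d j x)) \<partial>M)"
    by (rule nn_integral_suminf) measurable
  also have "\<dots> = (\<Sum>j. ennreal (\<integral>x. norm (d j x) \<partial>M))"
    by (subst nn_integral_eq_integral) (use d_int in auto)
  also have "\<dots> \<noteq> \<infinity>"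
    using summ by (simp add: ennreal_suminf_neq_top)
  finally have "AE x in M. (\<Sum>j. ennreal (norm (d j x))) \<noteq> \<infinity>"
    by (intro nn_integral_PInf_AE) auto
  then have conv: "AE x in M. (\<lambda>j. v (k j) x) \<longlonglongrightarrow> lim (\<lambda>j. v (k j) x)"
  proof eventually_elim
    case (elim x)
    then have "summable (\<lambda>j. norm (d j x))"
      by (intro summable_suminf_not_top) auto
    then have "summable (\<lambda>j. d j x)" by (rule summable_norm_cancel)
    then have "convergent (\<lambda>n. \<Sum>j<n. d j x)" by (simp add: summable_iff_convergent)
    then have "convergent (\<lambda>n. v (k 0) x + (\<Sum>j<n. d j x))"
      by (intro convergent_add convergent_const)
    moreover have "(\<Sum>j<n. d j x) = v (k n) x - v (k 0) x" for n
      unfolding d_def by (rule sum_lessThan_telescope)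
    ultimately show ?case by (simp add: convergent_LIMSEQ_iff)
  qed
  define w where "w x = lim (\<lambda>j. v (k j) x)" for x
  have [measurable]: "w \<in> borel_measurable M" unfolding w_def by measurable
  \<comment> \<open>Fatou in the second index only: \<open>n\<close> stays an arbitrary index beyond
    \<open>N j\<close>, so the estimate is not confined to the subsequence.\<close>
  have close: "(\<integral>\<^sup>+x. ennreal ((norm (v n x - w x))\<^sup>2) \<partial>M) \<le> ennreal ((1/4)^j)" if "n \<ge> N j" for n j
  proof -
    have "(\<integral>\<^sup>+x. ennreal ((norm (v n x - w x))\<^sup>2) \<partial>M)
        = (\<integral>\<^sup>+x. liminf (\<lambda>i. ennreal ((norm (v n x - v (k i) x))\<^sup>2)) \<partial>M)"
    proof (rule nn_integral_cong_AE, use conv in eventually_elim)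
      case (elim x)
      have "(\<lambda>i. ennreal ((norm (v n x - v (k i) x))\<^sup>2)) \<longlonglongrightarrow> ennreal ((norm (v n x - w x))\<^sup>2)"
        unfolding w_def by (intro tendsto_intros elim) 
      then show ?case by (intro lim_imp_Liminf[symmetric]) auto
    qed
    also have "\<dots> \<le> liminf (\<lambda>i. \<integral>\<^sup>+x. ennreal ((norm (v n x - v (k i) x))\<^sup>2) \<partial>M)"
      by (rule nn_integral_liminf) measurable
    also have "\<dots> \<le> ennreal ((1/4)^j)"
    proof (rule Liminf_le)
      show "\<forall>\<^sub>F i in sequentially. (\<integral>\<^sup>+x. ennreal ((norm (v n x - v (k i) x))\<^sup>2) \<partial>M) \<le> ennreal ((1/4)^j)"
        using eventually_ge_at_top[of j]
      proof eventually_elim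
        case (elim i)
        have "(\<integral>\<^sup>+x. ennreal ((norm (v n x - v (k i) x))\<^sup>2) \<partial>M)
          = ennreal (\<integral>x. (norm (v n x - v (k i) x))\<^sup>2 \<partial>M)"
          by (rule nn_integral_eq_integral) (use sqd in \<open>auto simp: square_integrable_def\<close>)
        also have "\<dots> \<le> ennreal ((1/4)^j)"
          using N[of j n "k i"] that k_ge[of j i] elim by (intro ennreal_leI) auto
        finally show ?case .
      qed
    qed simp
    finally show ?thesis .
  qed
  have sqi: "integrable M (\<lambda>x. (norm (v n x - w x))\<^sup>2)" if "n \<ge> N j" for n j
    using close[OF that] by (intro integrableI_bounded) (auto intro: le_less_trans)
  have "square_integrable M (\<lambda>x. v (N 0) x - w x)"
    using sqi[of 0 "N 0"] by (simp add: square_integrable_def)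
  from square_integrable_diff[OF v[of "N 0"] this] have w: "square_integrable M w" by simp
  moreover have "(\<lambda>n. \<integral>x. (norm (v n x - w x))\<^sup>2 \<partial>M) \<longlonglongrightarrow> 0"
  proof (rule LIMSEQ_I)
    fix r :: real assume "r > 0"
    then obtain j where j: "(1/4)^j < r" using real_arch_pow_inv[of r "1/4"] by auto
    have "norm ((\<integral>x. (norm (v n x - w x))\<^sup>2 \<partial>M) - 0) < r" if "n \<ge> N j" for n
    proof -
      have "ennreal (\<integral>x. (norm (v n x - w x))\<^sup>2 \<partial>M) \<le> ennreal ((1/4)^j)"
        using close[OF that] sqi[OF that] by (subst nn_integral_eq_integral[symmetric]) auto
      then have "(\<integral>x. (norm (v n x - w x))\<^sup>2 \<partial>M) \<le> (1/4)^j" by simp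
      moreover have "0 \<le> (\<integral>x. (norm (v n x - w x))\<^sup>2 \<partial>M)" by (rule integral_nonneg_AE) auto
      ultimately show ?thesis using j by simp
    qed
    then show "\<exists>no. \<forall>n\<ge>no. norm ((\<integral>x. (norm (v n x - w x))\<^sup>2 \<partial>M) - 0) < r" by blast
  qed
  ultimately show thesis by (rule that)
qed

subsection \<open>Periodic functions and integrals over a period\<close>

text \<open>A finite measure space stands in for the circle. The endpoints \<open>0\<close> and
  \<open>T\<close> are the same point counted twice, which is harmless because they form a null
  set.\<close>

abbreviation period_measure :: "real \<Rightarrow> real measure" where
  "period_measure T \<equiv> restrict_space lborel {0..T}"

lemma space_period_measure [simp]: "space (period_measure T) = {0..T}"
  by (simp add: space_restrict_space)

lemma finite_measure_period_measure: "finite_measure (period_measure T)"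
  by (rule finite_measureI) (simp add: emeasure_restrict_space emeasure_lborel_Icc_eq)

lemma measure_period_measure: "T \<ge> 0 \<Longrightarrow> measure (period_measure T) {0..T} = T"
  by (simp add: measure_restrict_space)

lemma set_integral_period_measure:
  fixes f :: "real \<Rightarrow> 'a::euclidean_space"
  shows "(LBINT t:{0..T}. f t) = (\<integral>t. f t \<partial>period_measure T)"
  by (simp add: set_lebesgue_integral_def integral_restrict_space)

lemma set_integrable_period_measure:
  fixes f :: "real \<Rightarrow> 'a::euclidean_space"
  shows "set_integrable lborel {0..T} f \<longleftrightarrow> integrable (period_measure T) f"
  by (simp add: set_integrable_def integrable_restrict_space)

lemma borel_measurable_period_measure:
  fixes f :: "real \<Rightarrow> 'a::euclidean_space"
  assumes "continuous_on {0..T} f"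
  shows "f \<in> borel_measurable (period_measure T)"
proof -
  have "f \<in> borel_measurable (restrict_space borel {0..T})"
    by (rule borel_measurable_continuous_on_restrict[OF assms])
  moreover have "sets (restrict_space borel {0..T}) = sets (period_measure T)"
    by (rule sets_restrict_space_cong) simp
  ultimately show ?thesis by (simp cong: measurable_cong_sets)
qed

lemma integrable_period_measure:
  fixes f :: "real \<Rightarrow> 'a::euclidean_space"
  assumes "continuous_on {0..T} f"
  shows "integrable (period_measure T) f"
  using borel_integrable_atLeastAtMost'[OF assms] by (simp add: set_integrable_period_measure)

lemma square_integrable_period_measure:
  fixes f :: "real \<Rightarrow> 'a::euclidean_space"
  assumes "continuous_on {0..T} f"
  shows "square_integrable (period_measure T) f"
  unfolding square_integrable_def
  by (intro conjI borel_measurable_period_measure integrable_period_measure continuous_intros assms)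

lemma set_integral_FTC:
  fixes f :: "real \<Rightarrow> 'a::euclidean_space"
  assumes "a \<le> b" "\<And>t. (F has_vector_derivative f t) (at t)" "continuous_on {a..b} f"
  shows "(LBINT t:{a..b}. f t) = F b - F a"
proof -
  have "(f has_integral (F b - F a)) {a..b}"
    using assms by (intro fundamental_theorem_of_calculus) (auto intro: has_vector_derivative_at_within)
  moreover have "(LBINT t:{a..b}. f t) = integral {a..b} f"
    by (rule set_borel_integral_eq_integral(2)[OF borel_integrable_atLeastAtMost'[OF assms(3)]])
  ultimately show ?thesis by (simp add: integral_unique)
qed

lemma continuous_integral_norm_sq_eq_0:
  fixes f :: "real \<Rightarrow> 'a::euclidean_space"
  assumes "T > 0" "continuous_on {0..T} f" "(\<integral>t. (norm (f t))\<^sup>2 \<partial>period_measure T) = 0" "t \<in> {0..T}"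
  shows "f t = 0"
proof -
  have c: "continuous_on {0..T} (\<lambda>t. (norm (f t))\<^sup>2)" by (intro continuous_intros assms)
  have "integral {0..T} (\<lambda>t. (norm (f t))\<^sup>2) = 0"
    using assms(3) set_borel_integral_eq_integral(2)[OF borel_integrable_atLeastAtMost'[OF c]]
    by (simp add: set_integral_period_measure)
  then have "((\<lambda>t. (norm (f t))\<^sup>2) has_integral 0) (cbox 0 T)"
    using integrable_integral[OF integrable_continuous_interval[OF c]] by simp
  then have "(norm (f t))\<^sup>2 = 0"
    by (rule has_integral_0_cbox_imp_0[rotated 2]) (use c assms in auto)
  then show ?thesis by simp
qed

lemma has_vector_derivative_zero_const:
  fixes f :: "real \<Rightarrow> 'a::real_normed_vector"
  assumes "\<And>t. (f has_vector_derivative 0) (at t)"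
  shows "f s = f t"
proof -
  have "\<And>t. (f has_derivative (\<lambda>h. 0)) (at t within UNIV)"
    using assms by (simp add: has_vector_derivative_def)
  from has_derivative_zero_constant[OF convex_UNIV this] show ?thesis by auto
qed

lemma periodic_fun_simple_rmod:
  assumes "periodic_fun_simple f T" "T > 0"
  shows "f (t rmod T) = f t"
proof -
  interpret periodic_fun_simple f T by fact
  have "t rmod T = t - of_int \<lfloor>t / T\<rfloor> * T"
    using assms(2) by (simp add: rmod_conv_frac frac_def field_simps)
  then show ?thesis using minus_of_int by simp
qed

text \<open>Translated copies of \<open>f\<close> are glued along the intervals between consecutive
  multiples of \<open>T\<close>.\<close>

lemma continuous_on_rmod:
  fixes f :: "real \<Rightarrow> 'a::topological_space"
  assumes T: "T > 0" and f: "continuous_on {0..T} f" "f 0 = f T"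
  shows "continuous_on UNIV (\<lambda>t. f (t rmod T))"
proof -
  let ?g = "\<lambda>t. f (t rmod T)"
  have seg: "continuous_on {of_int n * T..of_int (n + 1) * T} ?g" for n :: int
  proof (subst continuous_on_cong[OF refl])
    fix t assume t: "t \<in> {of_int n * T..of_int (n + 1) * T}"
    show "?g t = f (t - of_int n * T)"
    proof (cases "t = of_int (n + 1) * T")
      \<comment> \<open>At the right endpoint \<open>rmod\<close> has already jumped back to 0 while
        the translate still reads \<open>T\<close>; \<open>f 0 = f T\<close> reconciles the two
        values.\<close>
      case True
      then have "t rmod T = 0" "t - of_int n * T = T"
        by (simp only: rmod_self_multiple_int, simp add: algebra_simps)
      then show ?thesis using f(2) by simp
    next
      case False
      then have "t - of_int n * T \<in> {0..<\<bar>T\<bar>}" using t T by (auto simp: algebra_simps)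
      moreover have "[t = t - of_int n * T] (rmod T)"
        unfolding rcong_altdef by (rule exI[of _ "-n"]) (simp add: algebra_simps)
      ultimately have "t rmod T = t - of_int n * T"
        unfolding rcong_def by simp
      then show ?thesis by simp
    qed
  next
    show "continuous_on {of_int n * T..of_int (n + 1) * T} (\<lambda>t. f (t - of_int n * T))"
      by (rule continuous_on_compose2[OF f(1)]) (auto intro!: continuous_intros simp: algebra_simps)
  qed
  have "isCont ?g t" for t
  proof -
    define n where "n = \<lfloor>t / T\<rfloor>"
    have n: "of_int n \<le> t / T" "t / T < of_int (n + 1)" unfolding n_def by linarith+
    then have "of_int n * T \<le> t" "t < of_int (n + 1) * T" using T by (auto simp: field_simps)
    moreover have "of_int (n - 1) * T < of_int n * T" using T by simp
    ultimately have t: "of_int (n - 1) * T < t" "t < of_int (n + 1) * T" by linarith+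
    \<comment> \<open>A multiple of \<open>T\<close> lies on the boundary of its own interval, so
      the preceding interval is joined to make \<open>t\<close> an interior point.\<close>
    have "continuous_on ({of_int (n - 1) * T..of_int n * T} \<union> {of_int n * T..of_int (n + 1) * T}) ?g"
      using seg[of "n - 1"] seg[of n] by (intro continuous_on_closed_Un) auto
    moreover have "{of_int (n - 1) * T..of_int n * T} \<union> {of_int n * T..of_int (n + 1) * T}
        = {of_int (n - 1) * T..of_int (n + 1) * T}"
      using T by (intro ivl_disj_un_two_touch) auto
    ultimately have "continuous_on {of_int (n - 1) * T..of_int (n + 1) * T} ?g" by simp
    then show ?thesis by (rule continuous_on_interior) (use t in auto)
  qed
  then show ?thesis by (simp add: continuous_on_eq_continuous_at)
qed

lemma has_vector_derivative_shift:
  fixes f :: "real \<Rightarrow> 'a::real_normed_vector"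
  assumes "(f has_vector_derivative d) (at (t + a))"
  shows "((\<lambda>t. f (t + a)) has_vector_derivative d) (at t)"
proof -
  have "((\<lambda>t. t + a) has_real_derivative 1) (at t)" by (auto intro!: derivative_eq_intros)
  then have "((\<lambda>t. t + a) has_vector_derivative 1) (at t)"
    by (simp add: has_real_derivative_iff_has_vector_derivative)
  from vector_diff_chain_at[OF this assms] show ?thesis by (simp add: o_def)
qed

text \<open>The constant \<open>c\<close> is the mean of \<open>f\<close> over a period. An
  antiderivative drifts by \<open>T *\<^sub>R c\<close> per period, and removing the linear drift
  makes it periodic.\<close>

lemma periodic_antiderivative:
  fixes f :: "real \<Rightarrow> 'a::euclidean_space"
  assumes T: "T > 0" and f: "continuous_on UNIV f" "periodic_fun_simple f T"
  obtains F c where "\<And>t. (F has_vector_derivative f t - c) (at t)" "periodic_fun_simple F T"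
proof -
  have "\<exists>F. \<forall>t::real. -\<infinity> < ereal t \<longrightarrow> ereal t < \<infinity> \<longrightarrow> (F has_vector_derivative f t) (at t)"
    using f(1) by (intro einterval_antiderivative) (auto simp: continuous_on_eq_continuous_at)
  then obtain P where P: "\<And>t. (P has_vector_derivative f t) (at t)" by auto
  define c where "c = (P T - P 0) /\<^sub>R T"
  define F where "F t = P t - t *\<^sub>R c" for t
  have F: "(F has_vector_derivative f t - c) (at t)" for t
    unfolding F_def by (auto intro!: derivative_eq_intros P)
  have "((\<lambda>t. F (t + T) - F t) has_vector_derivative 0) (at t)" for t
  proof -
    have "((\<lambda>t. F (t + T)) has_vector_derivative f (t + T) - c) (at t)"
      by (rule has_vector_derivative_shift[OF F])
    from has_vector_derivative_diff[OF this F[of t]] show ?thesis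
      using periodic_fun_simple.plus_period[OF f(2)] by simp
  qed
  from has_vector_derivative_zero_const[OF this, of _ 0]
  have "F (t + T) - F t = F T - F 0" for t by simp
  moreover have "F T - F 0 = 0" using T by (simp add: F_def c_def)
  ultimately have "periodic_fun_simple F T" by unfold_locales simp
  with F show thesis by (rule that)
qed

subsection \<open>Weak derivatives\<close>

definition test_function :: "real \<Rightarrow> (real \<Rightarrow> real) \<Rightarrow> (real \<Rightarrow> real) \<Rightarrow> bool" where
  "test_function T \<phi> \<phi>' \<longleftrightarrow> periodic_fun_simple \<phi> T \<and> continuous_on UNIV \<phi>' \<and>
     (\<forall>t. (\<phi> has_real_derivative \<phi>' t) (at t))"

lemma has_weak_derivative_iff:
  "has_weak_derivative T x v \<longleftrightarrow> square_integrable (period_measure T) v \<and>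
     (\<forall>\<phi> \<phi>'. test_function T \<phi> \<phi>' \<longrightarrow>
        (\<integral>t. \<phi>' t *\<^sub>R x t \<partial>period_measure T) = - (\<integral>t. \<phi> t *\<^sub>R v t \<partial>period_measure T))"
  unfolding has_weak_derivative_def square_integrable_def test_function_def
    set_integral_period_measure set_integrable_period_measure set_borel_measurable_def
  by (simp add: borel_measurable_restrict_space_iff)

lemma test_function_continuous:
  assumes "test_function T \<phi> \<phi>'"
  shows "continuous_on S \<phi>" "continuous_on S \<phi>'"
proof -
  show "continuous_on S \<phi>"
    using assms by (intro DERIV_continuous_on[of _ _ \<phi>']) (auto simp: test_function_def intro: has_field_derivative_at_within)
  show "continuous_on S \<phi>'"
    using assms continuous_on_subset by (auto simp: test_function_def)
qed

lemma test_function_bounded: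
  assumes "test_function T \<phi> \<phi>'"
  obtains C where "C > 0" "\<And>t. t \<in> {0..T} \<Longrightarrow> \<bar>\<phi> t\<bar> \<le> C" "\<And>t. t \<in> {0..T} \<Longrightarrow> \<bar>\<phi>' t\<bar> \<le> C"
proof -
  have "bounded (\<phi> ` {0..T})" "bounded (\<phi>' ` {0..T})"
    using compact_continuous_image[OF test_function_continuous(1)[OF assms, of "{0..T}"]]
      compact_continuous_image[OF test_function_continuous(2)[OF assms, of "{0..T}"]]
    by (auto intro: compact_imp_bounded)
  then obtain A B where "A > 0" "B > 0" "\<forall>x\<in>\<phi> ` {0..T}. norm x \<le> A" "\<forall>x\<in>\<phi>' ` {0..T}. norm x \<le> B"
    by (meson bounded_pos)
  then show thesis by (intro that[of "max A B"]) (auto simp: le_max_iff_disj)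
qed

lemma test_function_scaleR_integrable:
  fixes f :: "real \<Rightarrow> 'a::euclidean_space"
  assumes "test_function T \<phi> \<phi>'" "integrable (period_measure T) f"
  shows "integrable (period_measure T) (\<lambda>t. \<phi> t *\<^sub>R f t)" "integrable (period_measure T) (\<lambda>t. \<phi>' t *\<^sub>R f t)"
proof -
  obtain C where "C > 0" "\<And>t. t \<in> {0..T} \<Longrightarrow> \<bar>\<phi> t\<bar> \<le> C" "\<And>t. t \<in> {0..T} \<Longrightarrow> \<bar>\<phi>' t\<bar> \<le> C"
    by (rule test_function_bounded[OF assms(1)]) blast
  then show "integrable (period_measure T) (\<lambda>t. \<phi> t *\<^sub>R f t)" "integrable (period_measure T) (\<lambda>t. \<phi>' t *\<^sub>R f t)"
    by (intro integrable_bounded_scaleR[where C = C] borel_measurable_period_measure test_function_continuous[OF assms(1)] assms(2); simp)+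
qed

lemma has_weak_derivative_square_integrable:
  "has_weak_derivative T x v \<Longrightarrow> square_integrable (period_measure T) v"
  by (simp add: has_weak_derivative_iff)

lemma has_weak_derivative_integrable:
  "has_weak_derivative T x v \<Longrightarrow> integrable (period_measure T) v"
  by (intro finite_measure.square_integrable_integrable[OF finite_measure_period_measure]
      has_weak_derivative_square_integrable)

lemma has_weak_derivative_linear:
  assumes x: "continuous_on {0..T} x" "has_weak_derivative T x v"
    and y: "continuous_on {0..T} y" "has_weak_derivative T y w"
  shows "has_weak_derivative T (\<lambda>t. a *\<^sub>R x t + b *\<^sub>R y t) (\<lambda>t. a *\<^sub>R v t + b *\<^sub>R w t)"
  unfolding has_weak_derivative_iff
proof (intro conjI allI impI)
  show "square_integrable (period_measure T) (\<lambda>t. a *\<^sub>R v t + b *\<^sub>R w t)"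
    using assms by (intro square_integrable_add square_integrable_scaleR has_weak_derivative_square_integrable)
  fix \<phi> \<phi>' assume p: "test_function T \<phi> \<phi>'"
  have i: "integrable (period_measure T) x" "integrable (period_measure T) y"
    "integrable (period_measure T) v" "integrable (period_measure T) w"
    using assms by (auto intro: integrable_period_measure has_weak_derivative_integrable)
  note [simp] = test_function_scaleR_integrable[OF p i(1)] test_function_scaleR_integrable[OF p i(2)]
    test_function_scaleR_integrable[OF p i(3)] test_function_scaleR_integrable[OF p i(4)]
  have eq: "(\<integral>t. \<phi>' t *\<^sub>R x t \<partial>period_measure T) = - (\<integral>t. \<phi> t *\<^sub>R v t \<partial>period_measure T)"
    "(\<integral>t. \<phi>' t *\<^sub>R y t \<partial>period_measure T) = - (\<integral>t. \<phi> t *\<^sub>R w t \<partial>period_measure T)"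
    using x(2) y(2) p by (auto simp: has_weak_derivative_iff)
  show "(\<integral>t. \<phi>' t *\<^sub>R (a *\<^sub>R x t + b *\<^sub>R y t) \<partial>period_measure T)
      = - (\<integral>t. \<phi> t *\<^sub>R (a *\<^sub>R v t + b *\<^sub>R w t) \<partial>period_measure T)"
  proof -
    have *: "(\<lambda>t. \<phi>' t *\<^sub>R (a *\<^sub>R x t + b *\<^sub>R y t)) = (\<lambda>t. a *\<^sub>R (\<phi>' t *\<^sub>R x t) + b *\<^sub>R (\<phi>' t *\<^sub>R y t))"
      "(\<lambda>t. \<phi> t *\<^sub>R (a *\<^sub>R v t + b *\<^sub>R w t)) = (\<lambda>t. a *\<^sub>R (\<phi> t *\<^sub>R v t) + b *\<^sub>R (\<phi> t *\<^sub>R w t))"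
      by (auto simp: algebra_simps)
    show ?thesis unfolding *
      by (subst (1 2) Bochner_Integration.integral_add)
         (simp_all add: eq del: scaleR_scaleR scaleR_left_commute)
  qed
qed

lemma has_weak_derivative_diff:
  assumes "continuous_on {0..T} x" "has_weak_derivative T x v"
    and "continuous_on {0..T} y" "has_weak_derivative T y w"
  shows "has_weak_derivative T (\<lambda>t. x t - y t) (\<lambda>t. v t - w t)"
  using has_weak_derivative_linear[OF assms, of 1 "-1"] by simp

lemma has_weak_derivative_C1:
  assumes "T \<ge> 0" "periodic_fun_simple y T" "\<And>t. (y has_vector_derivative y' t) (at t)" "continuous_on UNIV y'"
  shows "has_weak_derivative T y y'"
  unfolding has_weak_derivative_iff
proof (intro conjI allI impI)
  have y': "continuous_on {0..T} y'" using assms(4) continuous_on_subset by blast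
  show "square_integrable (period_measure T) y'" by (rule square_integrable_period_measure[OF y'])
  fix \<phi> \<phi>' assume p: "test_function T \<phi> \<phi>'"
  have y: "continuous_on {0..T} y"
    using assms(3) by (blast intro: continuous_at_imp_continuous_on has_vector_derivative_continuous)
  have d: "((\<lambda>t. \<phi> t *\<^sub>R y t) has_vector_derivative (\<phi> t *\<^sub>R y' t + \<phi>' t *\<^sub>R y t)) (at t)" for t
    using p by (intro has_vector_derivative_scaleR assms(3)) (auto simp: test_function_def)
  have "(\<integral>t. \<phi> t *\<^sub>R y' t + \<phi>' t *\<^sub>R y t \<partial>period_measure T) = \<phi> T *\<^sub>R y T - \<phi> 0 *\<^sub>R y 0"
    unfolding set_integral_period_measure[symmetric]
    by (rule set_integral_FTC[OF assms(1) d])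
       (intro continuous_intros y y' test_function_continuous[OF p])
  also have "\<dots> = 0"
    using periodic_fun_simple.plus_period[of \<phi> T 0] periodic_fun_simple.plus_period[of y T 0] p assms(2)
    by (simp add: test_function_def)
  finally show "(\<integral>t. \<phi>' t *\<^sub>R y t \<partial>period_measure T) = - (\<integral>t. \<phi> t *\<^sub>R y' t \<partial>period_measure T)"
    using test_function_scaleR_integrable[OF p integrable_period_measure[OF y]]
      test_function_scaleR_integrable[OF p integrable_period_measure[OF y']]
    by (simp add: add_eq_0_iff)
qed


text \<open>Weak derivatives are defined with scalar test functions. Each coordinate
  \<open>y t \<bullet> b\<close> is one, and summing over an orthonormal basis reassembles the inner
  product.\<close>

lemma weak_integration_by_parts:
  assumes x: "continuous_on {0..T} x" "has_weak_derivative T x v"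
    and y: "periodic_fun_simple y T" "\<And>t. (y has_vector_derivative y' t) (at t)" "continuous_on UNIV y'"
  shows "(\<integral>t. y' t \<bullet> x t \<partial>period_measure T) = - (\<integral>t. y t \<bullet> v t \<partial>period_measure T)"
proof -
  have y'c: "continuous_on {0..T} y'" using y(3) continuous_on_subset by blast
  have yc: "continuous_on {0..T} y"
    using y(2) by (blast intro: continuous_at_imp_continuous_on has_vector_derivative_continuous)
  have i: "integrable (period_measure T) x" "integrable (period_measure T) v"
    using x by (auto intro: integrable_period_measure has_weak_derivative_integrable)
  have p: "test_function T (\<lambda>t. y t \<bullet> b) (\<lambda>t. y' t \<bullet> b)" for b
    unfolding test_function_def
  proof (intro conjI allI)
    show "periodic_fun_simple (\<lambda>t. y t \<bullet> b) T"
      by unfold_locales (simp add: periodic_fun_simple.plus_period[OF y(1)])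
    show "continuous_on UNIV (\<lambda>t. y' t \<bullet> b)" by (intro continuous_intros y(3))
    show "((\<lambda>t. y t \<bullet> b) has_real_derivative y' t \<bullet> b) (at t)" for t
      unfolding has_real_derivative_iff_has_vector_derivative
      by (rule bounded_linear.has_vector_derivative[OF bounded_linear_inner_left y(2)])
  qed
  have b: "(\<integral>t. (y' t \<bullet> b) * (x t \<bullet> b) \<partial>period_measure T) = - (\<integral>t. (y t \<bullet> b) * (v t \<bullet> b) \<partial>period_measure T)" for b
  proof -
    have "(\<integral>t. (y' t \<bullet> b) *\<^sub>R x t \<partial>period_measure T) \<bullet> b = - (\<integral>t. (y t \<bullet> b) *\<^sub>R v t \<partial>period_measure T) \<bullet> b"
    proof -
      have "(\<integral>t. (y' t \<bullet> b) *\<^sub>R x t \<partial>period_measure T) = - (\<integral>t. (y t \<bullet> b) *\<^sub>R v t \<partial>period_measure T)"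
        using x(2) p[of b] unfolding has_weak_derivative_iff by blast
      then show ?thesis by simp
    qed
    then show ?thesis
      using test_function_scaleR_integrable[OF p[of b] i(1)] test_function_scaleR_integrable[OF p[of b] i(2)]
      by (simp flip: integral_inner_left)
  qed
  have I: "integrable (period_measure T) (\<lambda>t. (y' t \<bullet> b) * (x t \<bullet> b))" 
     "integrable (period_measure T) (\<lambda>t. (y t \<bullet> b) * (v t \<bullet> b))" for b
    using integrable_inner_left[OF test_function_scaleR_integrable(2)[OF p[of b] i(1)], of b]
     integrable_inner_left[OF test_function_scaleR_integrable(1)[OF p[of b] i(2)], of b]
    by simp_all
  show ?thesis
  proof -
    have "(\<integral>t. y' t \<bullet> x t \<partial>period_measure T) = (\<integral>t. (\<Sum>b\<in>Basis. (y' t \<bullet> b) * (x t \<bullet> b)) \<partial>period_measure T)"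
      by (rule Bochner_Integration.integral_cong[OF refl]) (rule euclidean_inner)
    also have "\<dots> = - (\<integral>t. (\<Sum>b\<in>Basis. (y t \<bullet> b) * (v t \<bullet> b)) \<partial>period_measure T)"
      by (simp add: I b sum_negf)
    also have "(\<integral>t. (\<Sum>b\<in>Basis. (y t \<bullet> b) * (v t \<bullet> b)) \<partial>period_measure T) = (\<integral>t. y t \<bullet> v t \<partial>period_measure T)"
      by (rule Bochner_Integration.integral_cong[OF refl]) (rule euclidean_inner[symmetric])
    finally show ?thesis .
  qed
qed

section \<open>Recovering a loop from its weak derivative\<close>

definition primitive :: "real \<Rightarrow> loop \<Rightarrow> loop" where
  "primitive T v t = (\<integral>u. indicator {..t} u *\<^sub>R v u \<partial>period_measure T)"

lemma integrable_indicator_period: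
  fixes v :: "real \<Rightarrow> 'a::euclidean_space"
  assumes "integrable (period_measure T) v" "A \<in> sets borel"
  shows "integrable (period_measure T) (\<lambda>u. indicator A u *\<^sub>R v u)"
  by (rule integrable_bounded_scaleR[OF assms(1), where C = 1])
     (use assms(2) in \<open>auto simp: indicator_def intro!: measurable_restrict_space1\<close>)

text \<open>Young's inequality with a free weight \<open>c\<close>, in place of Cauchy-Schwarz. A
  large \<open>c\<close> makes \<open>E / c\<close> small and a short interval then makes the other
  term small, while \<open>E = 0\<close> leaves only the first term. The different choices of
  \<open>c\<close> give continuity, equicontinuity, a bound on the oscillation, and
  constancy.\<close>

lemma primitive_diff_le:
  assumes v: "square_integrable (period_measure T) v" "(\<integral>u. (norm (v u))\<^sup>2 \<partial>period_measure T) \<le> E"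
    and st: "0 \<le> s" "s \<le> t" "t \<le> T" and "c > 0"
  shows "norm (primitive T v t - primitive T v s) \<le> (c * (t - s) + E / c) / 2"
proof -
  have vi: "integrable (period_measure T) v"
    by (rule finite_measure.square_integrable_integrable[OF finite_measure_period_measure v(1)])
  have sq: "integrable (period_measure T) (\<lambda>u. (norm (v u))\<^sup>2)"
    by (rule square_integrable_norm_sq[OF v(1)])
  have ind: "integrable (period_measure T) (\<lambda>u. indicator {s<..t} u :: real)"
    using integrable_indicator_period[of T "\<lambda>_. 1::real" "{s<..t}"] integrable_period_measure[of T "\<lambda>_. 1::real"] by simp
  have "primitive T v t - primitive T v s
      = (\<integral>u. indicator {..t} u *\<^sub>R v u - indicator {..s} u *\<^sub>R v u \<partial>period_measure T)"
    unfolding primitive_def using integrable_indicator_period[OF vi] by simp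
  also have "\<dots> = (\<integral>u. indicator {s<..t} u *\<^sub>R v u \<partial>period_measure T)"
    using st by (intro Bochner_Integration.integral_cong) (auto simp: indicator_def)
  also have "norm \<dots> \<le> (\<integral>u. (c * indicator {s<..t} u + (norm (v u))\<^sup>2 / c) / 2 \<partial>period_measure T)"
  proof (rule Bochner_Integration.integral_norm_bound_integral)
    show "norm (indicator {s<..t} u *\<^sub>R v u) \<le> (c * indicator {s<..t} u + (norm (v u))\<^sup>2 / c) / 2" for u
    proof -
      have "0 \<le> (norm (v u) - c)\<^sup>2" by simp
      then have "2 * c * norm (v u) \<le> c\<^sup>2 + (norm (v u))\<^sup>2"
        by (simp add: power2_eq_square algebra_simps)
      then have "norm (v u) \<le> (c + (norm (v u))\<^sup>2 / c) / 2"
        using \<open>c > 0\<close> by (simp add: field_simps power2_eq_square)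
      moreover have "0 \<le> (norm (v u))\<^sup>2 / c / 2" using \<open>c > 0\<close> by simp
      ultimately show ?thesis by (auto simp: indicator_def)
    qed
  qed (use ind sq integrable_indicator_period[OF vi] in auto)
  also have "\<dots> = (c * (\<integral>u. indicator {s<..t} u \<partial>period_measure T) + (\<integral>u. (norm (v u))\<^sup>2 \<partial>period_measure T) / c) / 2"
    using ind sq by simp
  also have "(\<integral>u. indicator {s<..t} u \<partial>period_measure T) = t - s"
  proof -
    have "(\<integral>u. indicator {s<..t} u \<partial>period_measure T) = (LINT u|lborel. indicator {s<..t} u :: real)"
    proof (subst integral_restrict_space)
      show "(LINT u|lborel. indicator {0..T} u *\<^sub>R (indicator {s<..t} u :: real)) = (LINT u|lborel. indicator {s<..t} u)"
        by (rule Bochner_Integration.integral_cong) (use st in \<open>auto simp: indicator_def\<close>)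
    qed simp
    also have "\<dots> = t - s" using st by simp
    finally show ?thesis .
  qed
  also have "(c * (t - s) + (\<integral>u. (norm (v u))\<^sup>2 \<partial>period_measure T) / c) / 2 \<le> (c * (t - s) + E / c) / 2"
    using v(2) \<open>c > 0\<close> by (simp add: divide_right_mono)
  finally show ?thesis .
qed

lemma primitive_dist_le:
  assumes v: "square_integrable (period_measure T) v" "(\<integral>u. (norm (v u))\<^sup>2 \<partial>period_measure T) \<le> E"
    and st: "s \<in> {0..T}" "t \<in> {0..T}" and "c > 0"
  shows "norm (primitive T v t - primitive T v s) \<le> (c * \<bar>t - s\<bar> + E / c) / 2"
  using primitive_diff_le[OF v, of s t c] primitive_diff_le[OF v, of t s c] st \<open>c > 0\<close>
  by (cases "s \<le> t") (auto simp: norm_minus_commute)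

lemma continuous_on_primitive:
  assumes v: "square_integrable (period_measure T) v"
  shows "continuous_on {0..T} (primitive T v)"
  unfolding continuous_on_iff
proof (intro ballI allI impI)
  fix s e :: real assume s: "s \<in> {0..T}" and e: "e > 0"
  define E where "E = (\<integral>u. (norm (v u))\<^sup>2 \<partial>period_measure T)"
  have E: "E \<ge> 0" unfolding E_def by (rule integral_nonneg_AE) auto
  \<comment> \<open>This weight makes \<open>E / c\<close> at most \<open>e\<close>, and on a window
    of width \<open>e / c\<close> the other term is below \<open>e\<close> too; the factor one half
    absorbs the sum. The summand 1 keeps \<open>c\<close> positive when
    \<open>E = 0\<close>.\<close>
  define c where "c = (E + 1) / e"
  have c: "c > 0" using E e by (simp add: c_def)
  show "\<exists>d>0. \<forall>t\<in>{0..T}. dist t s < d \<longrightarrow> dist (primitive T v t) (primitive T v s) < e"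
  proof (intro exI[of _ "e / c"] conjI ballI impI)
    show "e / c > 0" using e c by simp
    fix t assume t: "t \<in> {0..T}" "dist t s < e / c"
    have "norm (primitive T v t - primitive T v s) \<le> (c * \<bar>t - s\<bar> + E / c) / 2"
      using primitive_dist_le[OF v _ s t(1) c] by (simp add: E_def)
    also have "c * \<bar>t - s\<bar> < e" using t(2) c by (simp add: dist_real_def field_simps)
    also have "E / c \<le> e" using E e by (simp add: c_def field_simps)
    finally show "dist (primitive T v t) (primitive T v s) < e" by (simp add: dist_norm)
  qed
qed

lemma primitive_0: "primitive T v 0 = 0"
proof -
  have "AE u in lborel. u \<noteq> (0::real)" by (rule AE_lborel_singleton)
  then have "AE u in lborel. u \<in> {0..T} \<longrightarrow> indicator {..0} u *\<^sub>R v u = 0"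
    by eventually_elim (auto simp: indicator_def)
  then show ?thesis unfolding primitive_def
    by (intro integral_eq_zero_AE) (simp add: AE_restrict_space_iff)
qed

lemma primitive_T: "primitive T v T = (\<integral>u. v u \<partial>period_measure T)"
  unfolding primitive_def by (intro Bochner_Integration.integral_cong) auto

text \<open>Constants are periodic test functions; testing with 1 says that the velocity has mean
  zero.\<close>

lemma has_weak_derivative_integral_zero:
  assumes "has_weak_derivative T x v"
  shows "(\<integral>u. v u \<partial>period_measure T) = 0"
proof -
  have "test_function T (\<lambda>_. 1) (\<lambda>_. 0)"
    by (auto simp: test_function_def intro!: periodic_fun_simple.intro)
  then have "(\<integral>t. 0 *\<^sub>R x t \<partial>period_measure T) = - (\<integral>t. 1 *\<^sub>R v t \<partial>period_measure T)"
    using assms unfolding has_weak_derivative_iff by blast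
  then show ?thesis by simp
qed

text \<open>Fubini on the triangle \<open>u \<le> t\<close>: integrating \<open>\<phi>'\<close> from
  \<open>u\<close> to \<open>T\<close> leaves \<open>\<phi> T - \<phi> u\<close>, and the boundary
  term with \<open>\<phi> T\<close> drops out because \<open>v\<close> has mean zero.\<close>

lemma primitive_by_parts:
  assumes T: "T > 0" and p: "test_function T \<phi> \<phi>'"
    and v: "integrable (period_measure T) v" "(\<integral>u. v u \<partial>period_measure T) = 0"
  shows "(\<integral>t. \<phi>' t *\<^sub>R primitive T v t \<partial>period_measure T) = - (\<integral>t. \<phi> t *\<^sub>R v t \<partial>period_measure T)"
proof -
  let ?M = "period_measure T"
  interpret finite_measure ?M by (rule finite_measure_period_measure)
  interpret pair_sigma_finite ?M ?M by unfold_locales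
  obtain C where C: "C > 0" "\<And>t. t \<in> {0..T} \<Longrightarrow> \<bar>\<phi>' t\<bar> \<le> C"
    by (rule test_function_bounded[OF p]) blast
  have [measurable]: "v \<in> borel_measurable ?M" "\<phi>' \<in> borel_measurable ?M"
    using v(1) borel_measurable_period_measure[OF test_function_continuous(2)[OF p]] by auto
  have [measurable]: "(\<lambda>u. u) \<in> borel_measurable ?M" by (rule measurable_restrict_space1) auto
  define h where "h = (\<lambda>(u::real, t). if u \<le> t then \<phi>' t else 0)"
  have [measurable]: "h \<in> borel_measurable (?M \<Otimes>\<^sub>M ?M)"
    unfolding h_def by measurable
  have "integrable (?M \<Otimes>\<^sub>M ?M) (\<lambda>(u, t). v u)"
  proof (rule Fubini_integrable)
    show "integrable ?M (\<lambda>x. \<integral>y. norm (case (x, y) of (u, t) \<Rightarrow> v u) \<partial>?M)"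
      using v(1) by simp
  qed (use v(1) in simp_all)
  then have "integrable (?M \<Otimes>\<^sub>M ?M) (\<lambda>p. h p *\<^sub>R (case p of (u, t) \<Rightarrow> v u))"
  proof (rule integrable_bounded_scaleR)
    show "\<bar>h p\<bar> \<le> C" if "p \<in> space (?M \<Otimes>\<^sub>M ?M)" for p
      using that C(1) C(2)[of "snd p"] by (cases p) (auto simp: h_def space_pair_measure)
  qed measurable
  also have "(\<lambda>p. h p *\<^sub>R (case p of (u, t) \<Rightarrow> v u)) = (\<lambda>(u, t). h (u, t) *\<^sub>R v u)" by auto
  finally have int: "integrable (?M \<Otimes>\<^sub>M ?M) (\<lambda>(u, t). h (u, t) *\<^sub>R v u)" .
  have "(\<integral>t. \<phi>' t *\<^sub>R primitive T v t \<partial>?M) = (\<integral>t. (\<integral>u. h (u, t) *\<^sub>R v u \<partial>?M) \<partial>?M)"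
    unfolding primitive_def integral_scaleR_right[symmetric]
    by (intro Bochner_Integration.integral_cong) (auto simp: h_def indicator_def)
  also have "\<dots> = (\<integral>u. (\<integral>t. h (u, t) *\<^sub>R v u \<partial>?M) \<partial>?M)"
    by (rule Fubini_integral[OF int])
  also have "\<dots> = (\<integral>u. (\<phi> T - \<phi> u) *\<^sub>R v u \<partial>?M)"
  proof (rule Bochner_Integration.integral_cong[OF refl])
    fix u assume "u \<in> space ?M"
    then have u: "0 \<le> u" "u \<le> T" by auto
    have "(\<integral>t. h (u, t) \<partial>?M) = (LBINT t:{u..T}. \<phi>' t)"
      unfolding set_integral_period_measure[symmetric] set_lebesgue_integral_def
      by (intro Bochner_Integration.integral_cong) (use u in \<open>auto simp: h_def indicator_def\<close>)
    also have "\<dots> = \<phi> T - \<phi> u"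
      using p u by (intro set_integral_FTC test_function_continuous[OF p])
        (auto simp: test_function_def has_real_derivative_iff_has_vector_derivative)
    finally have *: "(\<integral>t. h (u, t) \<partial>?M) = \<phi> T - \<phi> u" .
    have "integrable ?M (\<lambda>t. h (u, t))"
    proof (rule integrable_const_bound[where B = C])
      show "AE t in ?M. norm (h (u, t)) \<le> C" using C by (intro AE_I2) (auto simp: h_def)
      show "(\<lambda>t. h (u, t)) \<in> borel_measurable ?M" unfolding h_def prod.case by measurable
    qed
    then show "(\<integral>t. h (u, t) *\<^sub>R v u \<partial>?M) = (\<phi> T - \<phi> u) *\<^sub>R v u"
      by (simp add: * integral_scaleR_left)
  qed
  also have "\<dots> = - (\<integral>t. \<phi> t *\<^sub>R v t \<partial>?M)"
    using v test_function_scaleR_integrable(1)[OF p v(1)] by (simp add: scaleR_diff_left)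
  finally show ?thesis .
qed

text \<open>The du Bois-Reymond lemma. The difference \<open>z\<close> of \<open>x\<close> and the
  primitive is orthogonal to the derivative of every test function, and every continuous periodic
  function of mean zero is such a derivative. Testing a coordinate of \<open>z\<close> with its own
  deviation from the mean shows that this deviation vanishes.\<close>

lemma weak_derivative_primitive:
  assumes T: "T > 0" and x: "periodic_fun_simple x T" "continuous_on {0..T} x" "has_weak_derivative T x v"
    and st: "s \<in> {0..T}" "t \<in> {0..T}"
  shows "x t - x s = primitive T v t - primitive T v s"
proof -
  let ?M = "period_measure T"
  interpret finite_measure ?M by (rule finite_measure_period_measure)
  note sq = has_weak_derivative_square_integrable[OF x(3)]
  note vi = has_weak_derivative_integrable[OF x(3)]
  note v0 = has_weak_derivative_integral_zero[OF x(3)]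
  define z where "z t = x t - primitive T v t" for t
  have zc: "continuous_on {0..T} z"
    unfolding z_def by (intro continuous_intros x continuous_on_primitive sq)
  have "x T = x 0" using periodic_fun_simple.plus_period[OF x(1), of 0] by simp
  \<comment> \<open>Mean zero of \<open>v\<close> gives the primitive equal endpoint values; this
    allows a continuous periodic extension of \<open>z\<close>.\<close>
  then have z0: "z 0 = z T" by (simp add: z_def primitive_0 primitive_T v0)
  have "z t \<bullet> b = z s \<bullet> b" for b
  proof -
    define \<psi> where "\<psi> t = z (t rmod T) \<bullet> b" for t
    have \<psi>c: "continuous_on UNIV \<psi>"
      unfolding \<psi>_def by (rule continuous_on_rmod[OF T, where f = "\<lambda>t. z t \<bullet> b"])
        (auto intro!: continuous_intros zc simp: z0)
    have \<psi>p: "periodic_fun_simple \<psi> T"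
    proof
      fix t
      have "[t + T = t] (rmod T)"
        unfolding rcong_altdef by (rule exI[of _ "-1"]) simp
      then have "(t + T) rmod T = t rmod T" by (simp add: rcong_def)
      then show "\<psi> (t + T) = \<psi> t" by (simp add: \<psi>_def)
    qed
    obtain \<phi> c where \<phi>: "\<And>t. (\<phi> has_vector_derivative \<psi> t - c) (at t)" "periodic_fun_simple \<phi> T"
      by (rule periodic_antiderivative[OF T \<psi>c \<psi>p]) blast
    have p: "test_function T \<phi> (\<lambda>t. \<psi> t - c)"
      using \<phi> \<psi>c by (auto simp: test_function_def has_real_derivative_iff_has_vector_derivative intro!: continuous_intros)
    have \<psi>z: "\<psi> t = z t \<bullet> b" if "t \<in> {0..T}" for t
      using that T z0 by (cases "t = T") (auto simp: \<psi>_def)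
    have i: "integrable ?M x" "integrable ?M (primitive T v)"
      by (intro integrable_period_measure x continuous_on_primitive sq)+
    note ti = test_function_scaleR_integrable(2)[OF p]
    have "(\<integral>t. (\<psi> t - c) *\<^sub>R z t \<partial>?M)
        = (\<integral>t. (\<psi> t - c) *\<^sub>R x t \<partial>?M) - (\<integral>t. (\<psi> t - c) *\<^sub>R primitive T v t \<partial>?M)"
      unfolding z_def using ti[OF i(1)] ti[OF i(2)] by (simp add: scaleR_diff_right)
    also have "\<dots> = 0"
      using primitive_by_parts[OF T p vi v0] x(3) p unfolding has_weak_derivative_iff by simp
    finally have "(\<integral>t. (\<psi> t - c) *\<^sub>R z t \<partial>?M) \<bullet> b = 0" by simp
    then have "(\<integral>t. (\<psi> t - c) * (z t \<bullet> b) \<partial>?M) = 0"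
      using ti[OF integrable_period_measure[OF zc]] by (simp flip: integral_inner_left)
    moreover have "(\<integral>t. (\<psi> t - c) * (z t \<bullet> b) \<partial>?M) = (\<integral>t. (\<psi> t - c) * \<psi> t \<partial>?M)"
      by (rule Bochner_Integration.integral_cong) (auto simp: \<psi>z)
    moreover have "(\<integral>t. \<psi> t - c \<partial>?M) = 0"
    proof -
      have "(LBINT t:{0..T}. \<psi> t - c) = \<phi> T - \<phi> 0"
        using T \<phi> by (intro set_integral_FTC test_function_continuous(2)[OF p]) auto
      then show ?thesis using periodic_fun_simple.plus_period[OF \<phi>(2), of 0]
        by (simp add: set_integral_period_measure)
    qed
    moreover have "integrable ?M \<psi>" "integrable ?M (\<lambda>t. \<psi> t - c)" "integrable ?M (\<lambda>t. (\<psi> t - c) * \<psi> t)"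
      by (auto intro!: integrable_period_measure continuous_intros continuous_on_subset[OF \<psi>c])
    \<comment> \<open>Subtracting \<open>c\<close> times the vanishing integral of
      \<open>\<psi> t - c\<close> completes the square.\<close>
    ultimately have "(\<integral>t. (\<psi> t - c) * \<psi> t - c * (\<psi> t - c) \<partial>?M) = 0"
      by (simp del: Bochner_Integration.integral_diff add: Bochner_Integration.integral_diff[of ?M "\<lambda>t. (\<psi> t - c) * \<psi> t" "\<lambda>t. c * (\<psi> t - c)"])
    then have "(\<integral>t. (norm (\<psi> t - c))\<^sup>2 \<partial>?M) = 0"
      by (simp add: power2_eq_square algebra_simps)
    then have "\<psi> t - c = 0" if "t \<in> {0..T}" for t
      by (rule continuous_integral_norm_sq_eq_0[OF T test_function_continuous(2)[OF p] _ that])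
    then show ?thesis using st \<psi>z by (metis eq_iff_diff_eq_0)
  qed
  then have "z t = z s" by (rule euclidean_eqI)
  then show ?thesis by (simp add: z_def algebra_simps)
qed

text \<open>A pi-lambda argument: the half-lines are closed under intersection and generate the
  Borel sets. The vanishing total integral is what the complement step uses.\<close>

lemma AE_eq_0_if_integral_atMost_0:
  fixes f :: "real \<Rightarrow> 'a::euclidean_space"
  assumes f: "integrable lborel f" and zero: "\<And>a. (LBINT t:{..a}. f t) = 0" "(LBINT t. f t) = 0"
  shows "AE t in lborel. f t = 0"
proof (rule sigma_finite_measure.density_zero[OF sigma_finite_lborel f])
  have si: "set_integrable lborel B f" if "B \<in> sets lborel" for B
    using that f unfolding set_integrable_def by (rule integrable_mult_indicator)
  fix A :: "real set" assume "A \<in> sets lborel"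
  then have A: "A \<in> sigma_sets UNIV (range atMost)" by (simp add: borel_eq_atMost)
  have s: "B \<in> sets lborel" if "B \<in> sigma_sets UNIV (range atMost)" for B :: "real set"
    using that by (simp add: borel_eq_atMost)
  have "Int_stable (range (atMost :: real \<Rightarrow> real set))"
    by (auto simp: Int_stable_def)
  moreover have "range atMost \<subseteq> Pow (UNIV :: real set)" by auto
  ultimately show "(LBINT t:A. f t) = 0" using A
  proof (induction rule: sigma_sets_induct_disjoint)
    case (basic B)
    then show ?case using zero(1) by auto
  next
    case empty
    show ?case by (simp add: set_lebesgue_integral_def)
  next
    case (compl B)
    have "(LBINT t:(UNIV - B) \<union> B. f t) = (LBINT t:UNIV - B. f t) + (LBINT t:B. f t)"
      using s[OF compl(1)] by (intro set_integral_Un si) auto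
    then show ?case using compl zero(2) by (simp add: set_lebesgue_integral_def)
  next
    case (union B)
    have m: "B i \<in> sets lborel" for i using union(2) by (intro s) auto
    have "(LBINT t:(\<Union>i. B i). f t) = (\<Sum>i. LBINT t:B i. f t)"
      using union(1) m by (intro lebesgue_integral_countable_add si) (auto simp: disjoint_family_on_def)
    then show ?case using union(3) by simp
  qed
qed

text \<open>The difference of two weak derivatives is a weak derivative of the zero loop, so its
  primitive vanishes, which says that its integrals over half-lines vanish. Thus the choice made by
  \<open>weak_derivative\<close> does not affect integrals.\<close>

lemma weak_derivative_unique:
  assumes T: "T > 0" and x: "continuous_on {0..T} x" "has_weak_derivative T x v" "has_weak_derivative T x w"
  shows "AE t in period_measure T. v t = w t"
proof -
  let ?M = "period_measure T"
  have h: "has_weak_derivative T (\<lambda>_. 0) (\<lambda>t. v t - w t)"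
    using has_weak_derivative_diff[OF x(1,2) x(1,3)] by simp
  define f where "f t = indicator {0..T} t *\<^sub>R (v t - w t)" for t
  have f: "integrable lborel f"
    using has_weak_derivative_integrable[OF h] unfolding f_def by (simp add: integrable_restrict_space)
  have prim: "primitive T (\<lambda>t. v t - w t) t = 0" if "t \<in> {0..T}" for t
    using weak_derivative_primitive[OF T _ _ h, of 0 t] that T
    by (simp add: primitive_0 periodic_fun_simple_def)
  have tot: "(LBINT t. f t) = 0"
    using has_weak_derivative_integral_zero[OF h] unfolding f_def by (simp add: integral_restrict_space)
  have "(LBINT t:{..a}. f t) = 0" for a
  proof -
    consider "a < 0" | "a \<in> {0..T}" | "a > T" by fastforce
    then show ?thesis
    proof cases
      case 1
      then have "(\<lambda>t. indicator {..a} t *\<^sub>R f t) = (\<lambda>_. 0)" by (auto simp: f_def indicator_def)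
      then show ?thesis by (simp add: set_lebesgue_integral_def)
    next
      case 2
      have "(\<lambda>t. indicator {..a} t *\<^sub>R f t) = (\<lambda>t. indicator {0..T} t *\<^sub>R (indicator {..a} t *\<^sub>R (v t - w t)))"
        by (auto simp: f_def mult.commute)
      with prim[OF 2] show ?thesis
        unfolding set_lebesgue_integral_def primitive_def by (simp only:) (simp add: integral_restrict_space)
    next
      case 3
      then have "indicator {..a} t *\<^sub>R f t = f t" for t by (auto simp: f_def indicator_def)
      then show ?thesis using tot unfolding set_lebesgue_integral_def by simp
    qed
  qed
  from AE_eq_0_if_integral_atMost_0[OF f this tot] have "AE t in lborel. f t = 0" .
  then have "AE t in lborel. t \<in> {0..T} \<longrightarrow> v t = w t"
    by eventually_elim (auto simp: f_def)
  then show ?thesis by (simp add: AE_restrict_space_iff)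
qed

subsection \<open>Weak lower semicontinuity\<close>

lemma integral_parallelogram:
  assumes "square_integrable M u" "square_integrable M w"
  shows "(\<integral>x. (norm (u x - w x))\<^sup>2 \<partial>M)
    = 2 * (\<integral>x. (norm (u x))\<^sup>2 \<partial>M) + 2 * (\<integral>x. (norm (w x))\<^sup>2 \<partial>M)
      - 4 * (\<integral>x. (norm ((1/2) *\<^sub>R u x + (1/2) *\<^sub>R w x))\<^sup>2 \<partial>M)"
proof -
  have eq: "(norm (a - b))\<^sup>2 = 2 * (norm a)\<^sup>2 + 2 * (norm b)\<^sup>2 - 4 * (norm ((1/2) *\<^sub>R a + (1/2) *\<^sub>R b))\<^sup>2"
    for a b :: 'b
    unfolding power2_norm_eq_inner by (simp add: inner_add inner_diff inner_commute algebra_simps)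
  have "integrable M (\<lambda>x. (norm ((1/2) *\<^sub>R u x + (1/2) *\<^sub>R w x))\<^sup>2)"
    by (intro square_integrable_norm_sq square_integrable_add square_integrable_scaleR assms)
  with square_integrable_norm_sq[OF assms(1)] square_integrable_norm_sq[OF assms(2)]
  show ?thesis unfolding eq by simp
qed

text \<open>Unlike the plain bound with factor 2, the factor on \<open>a\<close> tends to 1 with
  \<open>\<eta>\<close>, so a limit energy can be estimated without loss.\<close>

lemma norm_add_sq_le_weighted:
  fixes a b :: "'a::real_inner"
  assumes "\<eta> > 0"
  shows "(norm (a + b))\<^sup>2 \<le> (1 + \<eta>) * (norm a)\<^sup>2 + (1 + 1 / \<eta>) * (norm b)\<^sup>2"
proof -
  have "0 \<le> (norm (\<eta> *\<^sub>R a - b))\<^sup>2" by simp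
  then have "2 * \<eta> * (a \<bullet> b) \<le> \<eta>\<^sup>2 * (a \<bullet> a) + b \<bullet> b"
    unfolding power2_norm_eq_inner by (simp add: inner_diff inner_commute power2_eq_square algebra_simps)
  then have "2 * (a \<bullet> b) \<le> \<eta> * (a \<bullet> a) + (b \<bullet> b) / \<eta>"
    using assms by (simp add: field_simps power2_eq_square)
  then show ?thesis
    unfolding power2_norm_eq_inner using assms by (simp add: inner_add inner_commute field_simps)
qed

lemma integral_norm_sq_nonneg: "0 \<le> (\<integral>x. (norm (f x))\<^sup>2 \<partial>M)"
  by (rule integral_nonneg_AE) auto

text \<open>Instead of weak compactness: among the loops uniformly \<open>\<delta>\<close>-close to \<open>x\<close>, derivatives of almost
  minimal norm form, by the parallelogram identity, a Cauchy sequence as \<open>\<delta> \<rightarrow> 0\<close>.\<close>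

lemma weak_derivative_lower_semicontinuous:
  fixes x :: loop and X V :: "nat \<Rightarrow> loop"
  assumes T: "T > 0" and x: "continuous_on {0..T} x"
    and X: "\<And>n. continuous_on {0..T} (X n)" "\<And>n. has_weak_derivative T (X n) (V n)"
    and unif: "\<And>\<delta>. \<delta> > 0 \<Longrightarrow> \<exists>N. \<forall>n\<ge>N. \<forall>t\<in>{0..T}. norm (X n t - x t) \<le> \<delta>"
    and energy: "(\<lambda>n. \<integral>t. (norm (V n t))\<^sup>2 \<partial>period_measure T) \<longlonglongrightarrow> e"
  obtains w where "has_weak_derivative T x w" "(\<integral>t. (norm (w t))\<^sup>2 \<partial>period_measure T) \<le> e"
proof -
  let ?M = "period_measure T"
  interpret finite_measure ?M by (rule finite_measure_period_measure)
  define N where "N v = (\<integral>t. (norm (v t))\<^sup>2 \<partial>?M)" for v :: loop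
  have N0: "N v \<ge> 0" for v unfolding N_def by (rule integral_norm_sq_nonneg)
  define C where "C \<delta> = {w. \<exists>y. continuous_on {0..T} y \<and> has_weak_derivative T y w \<and>
      (\<forall>t\<in>{0..T}. norm (y t - x t) \<le> \<delta>)}" for \<delta>
  have C_mono: "C \<delta> \<subseteq> C \<delta>'" if "\<delta> \<le> \<delta>'" for \<delta> \<delta>'
    unfolding C_def using that by fastforce
  have VC: "\<exists>n0. \<forall>n\<ge>n0. V n \<in> C \<delta>" if "\<delta> > 0" for \<delta>
    using unif[OF that] X unfolding C_def by blast
  have C_sq: "square_integrable ?M w" if "w \<in> C \<delta>" for w \<delta>
    using that has_weak_derivative_square_integrable unfolding C_def by blast
  have bdd: "bdd_below (N ` C \<delta>)" for \<delta> using N0 by (auto intro!: bdd_belowI2[of _ 0])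
  \<comment> \<open>\<open>I\<close> grows as the radius shrinks, since fewer derivatives compete,
    and stays below \<open>e\<close>, since the tail of \<open>V\<close> competes at every radius.
    Hence it converges along \<open>d n\<close>.\<close>
  define I where "I \<delta> = Inf (N ` C \<delta>)" for \<delta>
  have I_le: "I \<delta> \<le> N w" if "w \<in> C \<delta>" for w \<delta>
    unfolding I_def using bdd that by (auto intro: cInf_lower)
  have ne: "C \<delta> \<noteq> {}" if "\<delta> > 0" for \<delta> using VC[OF that] by blast
  have I_mono: "I \<delta>' \<le> I \<delta>" if "0 < \<delta>" "\<delta> \<le> \<delta>'" for \<delta> \<delta>'
    unfolding I_def using ne[OF that(1)] C_mono[OF that(2)] by (intro cInf_superset_mono bdd) auto
  have I_e: "I \<delta> \<le> e" if "\<delta> > 0" for \<delta>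
  proof (rule LIMSEQ_le_const[OF energy])
    show "\<exists>n0. \<forall>n\<ge>n0. I \<delta> \<le> (\<integral>t. (norm (V n t))\<^sup>2 \<partial>?M)"
      using VC[OF that] I_le unfolding N_def by blast
  qed
  define d where "d n = 1 / real (Suc n)" for n
  have d0: "d n > 0" for n by (simp add: d_def)
  have d_lim: "d \<longlonglongrightarrow> 0" unfolding d_def by (rule LIMSEQ_Suc[OF lim_1_over_n])
  have d_anti: "d m \<le> d n" if "n \<le> m" for m n using that by (simp add: d_def frac_le)
  \<comment> \<open>One number \<open>d n\<close> serves both as the radius and as the allowed
    excess over the infimum.\<close>
  have "\<exists>w. w \<in> C (d n) \<and> N w < I (d n) + d n" for n
  proof -
    have "\<exists>z\<in>N ` C (d n). z < I (d n) + d n"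
      using cInf_lessD[of "N ` C (d n)" "I (d n) + d n"] ne[OF d0[of n]] d0[of n] unfolding I_def by auto
    then show ?thesis by auto
  qed
  then obtain w where w: "\<And>n. w n \<in> C (d n)" "\<And>n. N (w n) < I (d n) + d n" by metis
  have "incseq (\<lambda>n. I (d n))" unfolding incseq_def using I_mono d0 d_anti by blast
  then obtain L where "(\<lambda>n. I (d n)) \<longlonglongrightarrow> L"
    using I_e[OF d0] incseq_convergent[of "\<lambda>n. I (d n)" e] by blast
  then have I_cauchy: "Cauchy (\<lambda>n. I (d n))" by (rule LIMSEQ_imp_Cauchy)
  \<comment> \<open>Both derivatives lie in the larger class \<open>C (d n)\<close>, hence so does
    their midpoint, whose squared norm is then at least \<open>I (d n)\<close>. The parallelogram
    identity bounds their distance by the excess over this value.\<close>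
  have gap: "N (\<lambda>t. w m t - w n t) \<le> 2 * (I (d m) - I (d n)) + 4 * d n" if "n \<le> m" for m n
  proof -
    have mC: "w m \<in> C (d n)" using w(1)[of m] C_mono[OF d_anti[OF that]] by blast
    obtain y z where y: "continuous_on {0..T} y" "has_weak_derivative T y (w m)" "\<forall>t\<in>{0..T}. norm (y t - x t) \<le> d n"
      and z: "continuous_on {0..T} z" "has_weak_derivative T z (w n)" "\<forall>t\<in>{0..T}. norm (z t - x t) \<le> d n"
      using mC w(1)[of n] unfolding C_def by blast
    have "(\<lambda>t. (1/2) *\<^sub>R w m t + (1/2) *\<^sub>R w n t) \<in> C (d n)"
      unfolding C_def
    proof (intro CollectI exI[of _ "\<lambda>t. (1/2) *\<^sub>R y t + (1/2) *\<^sub>R z t"] conjI ballI)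
      show "has_weak_derivative T (\<lambda>t. (1/2) *\<^sub>R y t + (1/2) *\<^sub>R z t) (\<lambda>t. (1/2) *\<^sub>R w m t + (1/2) *\<^sub>R w n t)"
        by (rule has_weak_derivative_linear[OF y(1,2) z(1,2)])
      fix t assume t: "t \<in> {0..T}"
      have "(1/2) *\<^sub>R y t + (1/2) *\<^sub>R z t - x t = (1/2) *\<^sub>R (y t - x t) + (1/2) *\<^sub>R (z t - x t)"
        by (simp add: algebra_simps flip: scaleR_add_left)
      also have "norm \<dots> \<le> 1/2 * norm (y t - x t) + 1/2 * norm (z t - x t)"
        using norm_triangle_ineq[of "(1/2) *\<^sub>R (y t - x t)" "(1/2) *\<^sub>R (z t - x t)"] by simp
      also have "\<dots> \<le> d n" using y(3) z(3) t by fastforce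
      finally show "norm ((1/2) *\<^sub>R y t + (1/2) *\<^sub>R z t - x t) \<le> d n" .
    qed (intro continuous_intros y z)
    then obtain mid where mid: "mid = N (\<lambda>t. (1/2) *\<^sub>R w m t + (1/2) *\<^sub>R w n t)" "I (d n) \<le> mid"
      using I_le by blast
    have "N (\<lambda>t. w m t - w n t) = 2 * N (w m) + 2 * N (w n) - 4 * mid"
      unfolding N_def mid(1) by (rule integral_parallelogram[OF C_sq[OF w(1)] C_sq[OF w(1)]])
    moreover have "\<lbrakk>a = 2 * p + 2 * q - 4 * r; i \<le> r; p < j + e1; q < i + e2; e1 \<le> e2\<rbrakk> \<Longrightarrow> a \<le> 2 * (j - i) + 4 * e2"
      for a p q r i j e1 e2 :: real by argo
    ultimately show ?thesis using mid(2) w(2)[of m] w(2)[of n] d_anti[OF that] by blast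
  qed
  have cauchy: "\<exists>K. \<forall>m\<ge>K. \<forall>n\<ge>K. (\<integral>t. (norm (w m t - w n t))\<^sup>2 \<partial>?M) < r" if "r > 0" for r
  proof -
    obtain K1 where K1: "\<And>m n. m \<ge> K1 \<Longrightarrow> n \<ge> K1 \<Longrightarrow> dist (I (d m)) (I (d n)) < r / 8"
      using metric_CauchyD[OF I_cauchy, of "r / 8"] \<open>r > 0\<close> by auto
    obtain K2 where K2: "\<And>n. n \<ge> K2 \<Longrightarrow> d n < r / 8"
      using order_tendstoD(2)[OF d_lim, of "r / 8"] \<open>r > 0\<close> unfolding eventually_sequentially by auto
    have *: "N (\<lambda>t. w m t - w n t) < r" if "n \<le> m" "n \<ge> K1" "n \<ge> K2" for m n
    proof -
      have "dist (I (d m)) (I (d n)) < r / 8" by (rule K1) (use that in auto)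
      then have "I (d m) - I (d n) < r / 8" unfolding dist_real_def by linarith
      moreover have "\<lbrakk>a < r / 8; b \<le> 2 * a + 4 * c; c < r / 8\<rbrakk> \<Longrightarrow> b < r" for a b c :: real
        using \<open>r > 0\<close> by linarith
      ultimately show ?thesis using gap[OF that(1)] K2[OF that(3)] by blast
    qed
    have "(\<integral>t. (norm (w m t - w n t))\<^sup>2 \<partial>?M) < r" if "m \<ge> max K1 K2" "n \<ge> max K1 K2" for m n
      using *[of n m] *[of m n] that unfolding N_def by (cases "n \<le> m") (auto simp: norm_minus_commute)
    then show ?thesis by blast
  qed
  obtain u where u: "square_integrable ?M u" "(\<lambda>n. \<integral>t. (norm (w n t - u t))\<^sup>2 \<partial>?M) \<longlonglongrightarrow> 0"
    by (rule square_integrable_complete[of w]) (use C_sq[OF w(1)] cauchy in auto)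
  define a where "a n = N (\<lambda>t. w n t - u t)" for n
  have a: "a \<longlonglongrightarrow> 0" using u(2) by (simp add: a_def[abs_def] N_def)
  have sqd: "square_integrable ?M (\<lambda>t. w n t - u t)" for n
    by (intro square_integrable_diff C_sq[OF w(1)] u)
  have "N u \<le> e"
  proof -
    \<comment> \<open>The limit in \<open>n\<close> is taken with \<open>\<eta>\<close> fixed,
      because \<open>1 / \<eta>\<close> multiplies the vanishing term \<open>a n\<close>; only
      afterwards does \<open>\<eta>\<close> tend to 0.\<close>
    have "N u \<le> (1 + \<eta>) * e" if \<eta>: "\<eta> > 0" for \<eta>
    proof (rule LIMSEQ_le_const)
      have "(\<lambda>n. (1 + \<eta>) * (e + d n) + (1 + 1 / \<eta>) * a n) \<longlonglongrightarrow> (1 + \<eta>) * (e + 0) + (1 + 1 / \<eta>) * 0"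
        by (intro tendsto_intros d_lim a)
      then show "(\<lambda>n. (1 + \<eta>) * (e + d n) + (1 + 1 / \<eta>) * a n) \<longlonglongrightarrow> (1 + \<eta>) * e" by simp
      have "N u \<le> (1 + \<eta>) * (e + d n) + (1 + 1 / \<eta>) * a n" for n
      proof -
        have "N u \<le> (\<integral>t. (1 + \<eta>) * (norm (w n t))\<^sup>2 + (1 + 1 / \<eta>) * (norm (w n t - u t))\<^sup>2 \<partial>?M)"
          unfolding N_def
        proof (rule integral_mono)
          show "(norm (u t))\<^sup>2 \<le> (1 + \<eta>) * (norm (w n t))\<^sup>2 + (1 + 1 / \<eta>) * (norm (w n t - u t))\<^sup>2" for t
            using norm_add_sq_le_weighted[OF \<eta>, of "w n t" "u t - w n t"] by (simp add: norm_minus_commute)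
        qed (use square_integrable_norm_sq[OF C_sq[OF w(1)]] square_integrable_norm_sq[OF sqd]
            square_integrable_norm_sq[OF u(1)] in auto)
        also have "\<dots> = (1 + \<eta>) * N (w n) + (1 + 1 / \<eta>) * a n"
          unfolding N_def a_def
          using square_integrable_norm_sq[OF C_sq[OF w(1)]] square_integrable_norm_sq[OF sqd] by simp
        also have "N (w n) \<le> e + d n" using w(2)[of n] I_e[OF d0[of n]] by linarith
        finally show ?thesis using \<eta> by simp
      qed
      then show "\<exists>n0. \<forall>n\<ge>n0. N u \<le> (1 + \<eta>) * (e + d n) + (1 + 1 / \<eta>) * a n" by blast
    qed
    note * = this
    have "((\<lambda>\<eta>. (1 + \<eta>) * e) \<longlongrightarrow> (1 + 0) * e) (at_right 0)" by (intro tendsto_intros)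
    then show ?thesis
      by (intro tendsto_lowerbound[of "\<lambda>\<eta>. (1 + \<eta>) * e" e "at_right 0"])
         (use * in \<open>auto simp: eventually_at_filter\<close>)
  qed
  moreover have "has_weak_derivative T x u"
    unfolding has_weak_derivative_iff
  proof (intro conjI allI impI u(1))
    fix \<phi> \<phi>' assume p: "test_function T \<phi> \<phi>'"
    obtain B where B: "B > 0" "\<And>t. t \<in> {0..T} \<Longrightarrow> \<bar>\<phi> t\<bar> \<le> B" "\<And>t. t \<in> {0..T} \<Longrightarrow> \<bar>\<phi>' t\<bar> \<le> B"
      by (rule test_function_bounded[OF p]) blast
    \<comment> \<open>Each \<open>w n\<close> is the derivative of some \<open>y n\<close> close to
      \<open>x\<close>. In its weak identity the left side converges because \<open>y n\<close>
      tends to \<open>x\<close> uniformly, the right side because \<open>w n\<close> tends to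
      \<open>u\<close> in L2.\<close>
    have "\<exists>y. \<forall>n. continuous_on {0..T} (y n) \<and> has_weak_derivative T (y n) (w n) \<and>
        (\<forall>t\<in>{0..T}. norm (y n t - x t) \<le> d n)"
      using w(1) unfolding C_def by (intro choice) blast
    then obtain y where y: "\<And>n. continuous_on {0..T} (y n)" "\<And>n. has_weak_derivative T (y n) (w n)"
      "\<And>n t. t \<in> {0..T} \<Longrightarrow> norm (y n t - x t) \<le> d n" by blast
    note xi = integrable_period_measure[OF x]
    note yi = integrable_period_measure[OF y(1)]
    note ui = square_integrable_integrable[OF u(1)]
    note wi = has_weak_derivative_integrable[OF y(2)]
    note ti = test_function_scaleR_integrable[OF p]
    have "(\<lambda>n. (\<integral>t. \<phi>' t *\<^sub>R y n t \<partial>?M)) \<longlonglongrightarrow> (\<integral>t. \<phi>' t *\<^sub>R x t \<partial>?M)"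
    proof (rule Lim_null_comparison[of _ "\<lambda>n. B * T * d n", THEN LIM_zero_cancel])
      show "(\<lambda>n. B * T * d n) \<longlonglongrightarrow> 0" using tendsto_mult_right_zero[OF d_lim] by auto
      have "norm ((\<integral>t. \<phi>' t *\<^sub>R y n t \<partial>?M) - (\<integral>t. \<phi>' t *\<^sub>R x t \<partial>?M)) \<le> B * T * d n" for n
      proof -
        have "(\<integral>t. \<phi>' t *\<^sub>R y n t \<partial>?M) - (\<integral>t. \<phi>' t *\<^sub>R x t \<partial>?M) = (\<integral>t. \<phi>' t *\<^sub>R (y n t - x t) \<partial>?M)"
          using ti(2)[OF yi] ti(2)[OF xi] by (simp add: scaleR_diff_right)
        also have "norm \<dots> \<le> (\<integral>t. B * d n \<partial>?M)"
        proof (rule Bochner_Integration.integral_norm_bound_integral)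
          show "integrable ?M (\<lambda>t. \<phi>' t *\<^sub>R (y n t - x t))"
            by (intro ti Bochner_Integration.integrable_diff yi xi)
          show "norm (\<phi>' t *\<^sub>R (y n t - x t)) \<le> B * d n" if "t \<in> space ?M" for t
            using that B(3)[of t] y(3)[of t n] B(1) by (auto intro!: mult_mono)
        qed simp
        also have "\<dots> = B * T * d n" using T by (simp add: measure_period_measure)
        finally show ?thesis .
      qed
      then show "\<forall>\<^sub>F n in sequentially. norm ((\<integral>t. \<phi>' t *\<^sub>R y n t \<partial>?M) - (\<integral>t. \<phi>' t *\<^sub>R x t \<partial>?M)) \<le> B * T * d n"
        by simp
    qed
    moreover have "(\<lambda>n. (\<integral>t. \<phi> t *\<^sub>R w n t \<partial>?M)) \<longlonglongrightarrow> (\<integral>t. \<phi> t *\<^sub>R u t \<partial>?M)"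
    proof (rule Lim_null_comparison[of _ "\<lambda>n. B * sqrt (T * a n)", THEN LIM_zero_cancel])
      have "(\<lambda>n. B * sqrt (T * a n)) \<longlonglongrightarrow> B * sqrt (T * 0)" by (intro tendsto_intros a)
      then show "(\<lambda>n. B * sqrt (T * a n)) \<longlonglongrightarrow> 0" by simp
      have "norm ((\<integral>t. \<phi> t *\<^sub>R w n t \<partial>?M) - (\<integral>t. \<phi> t *\<^sub>R u t \<partial>?M)) \<le> B * sqrt (T * a n)" for n
      proof -
        have "(\<integral>t. \<phi> t *\<^sub>R w n t \<partial>?M) - (\<integral>t. \<phi> t *\<^sub>R u t \<partial>?M) = (\<integral>t. \<phi> t *\<^sub>R (w n t - u t) \<partial>?M)"
          using ti(1)[OF wi] ti(1)[OF ui] by (simp add: scaleR_diff_right)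
        also have "norm \<dots> \<le> (\<integral>t. B * norm (w n t - u t) \<partial>?M)"
        proof (rule Bochner_Integration.integral_norm_bound_integral)
          show "integrable ?M (\<lambda>t. \<phi> t *\<^sub>R (w n t - u t))"
            by (intro ti Bochner_Integration.integrable_diff wi ui)
          show "integrable ?M (\<lambda>t. B * norm (w n t - u t))" using wi[of n] ui by simp
          show "norm (\<phi> t *\<^sub>R (w n t - u t)) \<le> B * norm (w n t - u t)" if "t \<in> space ?M" for t
            using that B(2)[of t] by (auto intro!: mult_right_mono)
        qed
        also have "\<dots> = B * (\<integral>t. norm (w n t - u t) \<partial>?M)" by simp
        also have "(\<integral>t. norm (w n t - u t) \<partial>?M) \<le> sqrt (T * a n)"
          using integral_norm_sq_le[OF sqd[of n]] T unfolding a_def N_def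
          by (intro real_le_rsqrt) (simp add: measure_period_measure)
        finally show ?thesis using B(1) by simp
      qed
      then show "\<forall>\<^sub>F n in sequentially. norm ((\<integral>t. \<phi> t *\<^sub>R w n t \<partial>?M) - (\<integral>t. \<phi> t *\<^sub>R u t \<partial>?M)) \<le> B * sqrt (T * a n)"
        by simp
    qed
    then have "(\<lambda>n. - (\<integral>t. \<phi> t *\<^sub>R w n t \<partial>?M)) \<longlonglongrightarrow> - (\<integral>t. \<phi> t *\<^sub>R u t \<partial>?M)" by (rule tendsto_minus)
    moreover have "(\<integral>t. \<phi>' t *\<^sub>R y n t \<partial>?M) = - (\<integral>t. \<phi> t *\<^sub>R w n t \<partial>?M)" for n
      using y(2)[of n] p unfolding has_weak_derivative_iff by blast
    ultimately show "(\<integral>t. \<phi>' t *\<^sub>R x t \<partial>?M) = - (\<integral>t. \<phi> t *\<^sub>R u t \<partial>?M)"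
      using LIMSEQ_unique by auto
  qed
  ultimately show thesis using that unfolding N_def by blast
qed

subsection \<open>The symmetric loops\<close>

lemma plane_rotation_pi: "plane_rotation pi *v p = - p"
  unfolding vec_eq_iff forall_2
  by (simp add: plane_rotation_def matrix_vector_mult_def sum_2)

text \<open>The loops \<open>(q(t + T/3), q(t + 2T/3), q(t))\<close> with \<open>q = x\<^sub>3\<close> odd and \<open>T\<close>-periodic.\<close>

definition odd_choreography :: "real \<Rightarrow> loop \<Rightarrow> bool" where
  "odd_choreography T x \<longleftrightarrow> periodic_fun_simple x T \<and> (\<forall>t. x (- t) $ 3 = - x t $ 3) \<and>
     (\<forall>t. x t $ 1 = x (t + T / 3) $ 3) \<and> (\<forall>t. x t $ 2 = x (t + 2 * T / 3) $ 3)"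

lemma odd_choreographyD:
  assumes "odd_choreography T x"
  shows "periodic_fun_simple x T" "x (- t) $ 3 = - x t $ 3"
    "x t $ 1 = x (t + T / 3) $ 3" "x t $ 2 = x (t + 2 * T / 3) $ 3"
  using assms by (auto simp: odd_choreography_def)

lemma odd_choreography_shift:
  assumes "odd_choreography T x"
  shows "x (t + T / 3) $ 1 = x t $ 2" "x (t + T / 3) $ 2 = x t $ 3" "x (t + T / 3) $ 3 = x t $ 1"
proof -
  note o = odd_choreographyD[OF assms]
  show "x (t + T / 3) $ 1 = x t $ 2" using o(3)[of "t + T / 3"] o(4)[of t] by (simp add: add.commute)
  show "x (t + T / 3) $ 2 = x t $ 3"
    using o(4)[of "t + T / 3"] periodic_fun_simple.plus_period[OF o(1), of t] by (simp add: add.commute)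
  show "x (t + T / 3) $ 3 = x t $ 1" using o(3)[of t] by simp
qed

text \<open>The two conditions are invariance under \<open>h\<^sub>1\<close> and
  \<open>h\<^sub>2\<close>. Since \<open>(1 2)\<close> fixes index 3, the first alone makes body 3
  odd. Composing both, the two time reflections give a shift by \<open>T / 3\<close>, the two sign
  changes cancel, and the transpositions give a 3-cycle of the bodies.\<close>

lemma odd_choreography_iff:
  "odd_choreography T x \<longleftrightarrow> periodic_fun_simple x T \<and>
     (\<forall>t i. x t $ i = - x (- t) $ Transposition.transpose 1 2 i) \<and>
     (\<forall>t i. x t $ i = - x (T / 3 - t) $ Transposition.transpose 2 3 i)"
    (is "?L \<longleftrightarrow> ?R")
proof
  assume L: ?L
  note o = odd_choreographyD[OF L]
  note s = odd_choreography_shift[OF L]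
  interpret periodic_fun_simple x T by (rule o(1))
  have a: "x t $ 1 = - x (- t) $ 2" for t
  proof -
    have "x (- t) $ 2 = x (- (t - 2 * T / 3)) $ 3" using o(4)[of "- t"] by simp
    also have "\<dots> = - x (t - 2 * T / 3 + T) $ 3"
      using o(2)[of "t - 2 * T / 3"] plus_period[of "t - 2 * T / 3"] by simp
    also have "t - 2 * T / 3 + T = t + T / 3" by (simp add: field_simps)
    finally show ?thesis using o(3)[of t] by simp
  qed
  have b: "x t $ 2 = - x (- t) $ 1" for t using a[of "- t"] by simp
  have c: "x t $ 3 = - x (- t) $ 3" for t using o(2)[of t] by simp
  have d: "x (T / 3 - t) $ 1 = x (- t) $ 2" "x (T / 3 - t) $ 2 = x (- t) $ 3" "x (T / 3 - t) $ 3 = x (- t) $ 1" for t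
    using s[of "- t"] by simp_all
  have "x t $ i = - x (- t) $ Transposition.transpose 1 2 i" for t i
  proof -
    consider "i = 1" | "i = 2" | "i = 3" using exhaust_3 by blast
    then show ?thesis by cases (use a[of t] b[of t] c[of t] in \<open>simp_all add: Transposition.transpose_def\<close>)
  qed
  moreover have "x t $ i = - x (T / 3 - t) $ Transposition.transpose 2 3 i" for t i
  proof -
    consider "i = 1" | "i = 2" | "i = 3" using exhaust_3 by blast
    then show ?thesis
      by cases (use a[of t] b[of t] c[of t] d[of t] in \<open>simp_all add: Transposition.transpose_def\<close>)
  qed
  ultimately show ?R using o(1) by blast
next
  assume R: ?R
  then have p: "periodic_fun_simple x T"
    and r1: "\<And>t i. x t $ i = - x (- t) $ Transposition.transpose 1 2 i"
    and r2: "\<And>t i. x t $ i = - x (T / 3 - t) $ Transposition.transpose 2 3 i"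
    by blast+
  have h1: "x t $ 1 = - x (- t) $ 2" "x t $ 2 = - x (- t) $ 1" "x t $ 3 = - x (- t) $ 3" for t
    using r1[of t 1] r1[of t 2] r1[of t 3] by (simp_all add: Transposition.transpose_def)
  have h2: "x t $ 1 = - x (T / 3 - t) $ 1" "x t $ 2 = - x (T / 3 - t) $ 3" for t
    using r2[of t 1] r2[of t 2] by (simp_all add: Transposition.transpose_def)
  interpret periodic_fun_simple x T by (rule p)
  have A: "x t $ 1 = x (t + T / 3) $ 3" for t
    using h1(1)[of t] h2(2)[of "- t"] by (simp add: add.commute)
  have B: "x t $ 2 = x (t + T / 3) $ 1" for t
    using h1(2)[of t] h2(1)[of "- t"] by (simp add: add.commute)
  have C: "x t $ 2 = x (t + 2 * T / 3) $ 3" for t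
    using A[of "t + T / 3"] B[of t] by (simp add: add.commute)
  have "x (- t) $ 3 = - x t $ 3" for t using h1(3)[of t] by simp
  then show ?L unfolding odd_choreography_def using p A C by blast
qed

section \<open>The loops fixed by the group action\<close>

locale eight_symmetry =
  fixes T :: real
    and G :: "('g, 'm) monoid_scheme"
    and h\<^sub>1 h\<^sub>2 :: 'g
    and \<tau> :: "'g \<Rightarrow> real \<Rightarrow> real"
    and \<rho> :: "'g \<Rightarrow> real^2^2"
    and \<sigma> :: "'g \<Rightarrow> 3 \<Rightarrow> 3"
  assumes T: "T > 0"
    and G: "D3_generated_by G h\<^sub>1 h\<^sub>2"
    and time_action: "group_action G {0..<T} \<tau>"
    and plane_action: "\<rho> \<in> hom G orthogonal_group"
    and index_action: "group_action G UNIV \<sigma>"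
    and \<tau>_h1: "\<forall>t\<in>{0..<T}. \<tau> h\<^sub>1 t = (- t) rmod T"
    and \<tau>_h2: "\<forall>t\<in>{0..<T}. \<tau> h\<^sub>2 t = (T / 3 - t) rmod T"
    and \<rho>_h1: "\<rho> h\<^sub>1 = plane_rotation pi"
    and \<rho>_h2: "\<rho> h\<^sub>2 = plane_rotation pi"
    and \<sigma>_h1: "\<sigma> h\<^sub>1 = Transposition.transpose 1 2"
    and \<sigma>_h2: "\<sigma> h\<^sub>2 = Transposition.transpose 2 3"
begin

sublocale group G using G by (simp add: D3_generated_by_def)
sublocale time: group_action G "{0..<T}" \<tau> by (rule time_action)
sublocale index: group_action G UNIV \<sigma> by (rule index_action)

abbreviation act :: "'g \<Rightarrow> loop \<Rightarrow> loop" where "act \<equiv> loop_action T G \<tau> \<rho> \<sigma>"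

lemma generators: "h\<^sub>1 \<in> carrier G" "h\<^sub>2 \<in> carrier G" "inv\<^bsub>G\<^esub> h\<^sub>1 = h\<^sub>1" "inv\<^bsub>G\<^esub> h\<^sub>2 = h\<^sub>2"
  "generate G {h\<^sub>1, h\<^sub>2} = carrier G"
  using G by (auto simp: D3_generated_by_def intro: inv_equality)

lemma rmod_mem: "t rmod T \<in> {0..<T}"
  using T by (auto intro: rmod_less rmod_nonneg)

text \<open>Both reductions to \<open>{0..<T}\<close> are invisible to a periodic loop, so the
  generators may be treated as reflections of the whole line.\<close>

lemma periodic_reflect_rmod:
  assumes "periodic_fun_simple x T"
  shows "x ((a - t rmod T) rmod T) = x (a - t)"
proof -
  interpret periodic_fun_simple x T by fact
  have "periodic_fun_simple (\<lambda>s. x (a - s)) T"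
  proof
    show "x (a - (s + T)) = x (a - s)" for s
      using minus_1[of "a - s"] by (simp add: algebra_simps)
  qed
  from periodic_fun_simple_rmod[OF this T, of t] show ?thesis
    using periodic_fun_simple_rmod[OF assms T] by simp
qed

text \<open>The generator and its transposition are involutions, so the inverses in the action
  disappear, and rotation by pi is the sign change.\<close>

lemma act_h1_iff:
  assumes "periodic_fun_simple x T"
  shows "act h\<^sub>1 x = x \<longleftrightarrow> (\<forall>t i. x t $ i = - x (- t) $ Transposition.transpose 1 2 i)"
proof -
  have *: "act h\<^sub>1 x t $ i = - x (- t) $ Transposition.transpose 1 2 i" for t i
    using \<tau>_h1 rmod_mem[of t] periodic_reflect_rmod[OF assms, of 0 t]
    by (simp add: loop_action_def config_action_def generators \<rho>_h1 \<sigma>_h1 plane_rotation_pi)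
  have "act h\<^sub>1 x = x \<longleftrightarrow> (\<forall>t i. x t $ i = act h\<^sub>1 x t $ i)"
    by (metis ext vec_eq_iff)
  then show ?thesis unfolding * .
qed

lemma act_h2_iff:
  assumes "periodic_fun_simple x T"
  shows "act h\<^sub>2 x = x \<longleftrightarrow> (\<forall>t i. x t $ i = - x (T / 3 - t) $ Transposition.transpose 2 3 i)"
proof -
  have *: "act h\<^sub>2 x t $ i = - x (T / 3 - t) $ Transposition.transpose 2 3 i" for t i
    using \<tau>_h2 rmod_mem[of t] periodic_reflect_rmod[OF assms, of "T / 3" t]
    by (simp add: loop_action_def config_action_def generators \<rho>_h2 \<sigma>_h2 plane_rotation_pi)
  have "act h\<^sub>2 x = x \<longleftrightarrow> (\<forall>t i. x t $ i = act h\<^sub>2 x t $ i)"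
    by (metis ext vec_eq_iff)
  then show ?thesis unfolding * .
qed

text \<open>Inversion reverses the order of composition of the permutations, and substituting into
  an index reverses it again; this is why the inverse of \<open>\<sigma> g\<close> gives a left
  action.\<close>

lemma config_action_mult:
  assumes "g \<in> carrier G" "h \<in> carrier G"
  shows "config_action \<rho> \<sigma> (g \<otimes>\<^bsub>G\<^esub> h) x = config_action \<rho> \<sigma> g (config_action \<rho> \<sigma> h x)"
proof -
  have \<rho>: "\<rho> (g \<otimes>\<^bsub>G\<^esub> h) = \<rho> g ** \<rho> h"
    using hom_mult[OF plane_action assms] by (simp add: orthogonal_group_def)
  have "\<sigma> (g \<otimes>\<^bsub>G\<^esub> h) = \<sigma> g \<circ> \<sigma> h"
    using index.composition_rule[OF _ assms] by (auto simp: fun_eq_iff)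
  moreover have "bij (\<sigma> g)" "bij (\<sigma> h)"
    using index.bij_prop0 assms by (auto simp: Bij_def)
  ultimately have "inv_into UNIV (\<sigma> (g \<otimes>\<^bsub>G\<^esub> h)) = inv_into UNIV (\<sigma> h) \<circ> inv_into UNIV (\<sigma> g)"
    by (simp add: o_inv_distrib)
  then show ?thesis
    by (simp add: config_action_def \<rho> matrix_vector_mul_assoc)
qed

lemma act_mult:
  assumes "g \<in> carrier G" "h \<in> carrier G"
  shows "act (g \<otimes>\<^bsub>G\<^esub> h) x = act g (act h x)"
proof
  fix t
  \<comment> \<open>The time action stays inside the chosen representatives, so the second reduction
    by \<open>rmod\<close> changes nothing.\<close>
  have "\<tau> (inv\<^bsub>G\<^esub> g) (t rmod T) \<in> {0..<T}"
    using time.element_image[OF _ rmod_mem[of t] refl, of "inv\<^bsub>G\<^esub> g"] assms by simp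
  then have "\<tau> (inv\<^bsub>G\<^esub> g) (t rmod T) rmod T = \<tau> (inv\<^bsub>G\<^esub> g) (t rmod T)" by simp
  moreover have "\<tau> (inv\<^bsub>G\<^esub> (g \<otimes>\<^bsub>G\<^esub> h)) (t rmod T) = \<tau> (inv\<^bsub>G\<^esub> h) (\<tau> (inv\<^bsub>G\<^esub> g) (t rmod T))"
    using time.composition_rule[OF rmod_mem[of t], of "inv\<^bsub>G\<^esub> h" "inv\<^bsub>G\<^esub> g"] assms
    by (simp add: inv_mult_group)
  ultimately show "act (g \<otimes>\<^bsub>G\<^esub> h) x t = act g (act h x) t"
    by (simp add: loop_action_def config_action_mult[OF assms])
qed

lemma act_one:
  assumes "periodic_fun_simple x T"
  shows "act \<one>\<^bsub>G\<^esub> x = x"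
proof -
  have h: "h\<^sub>1 \<otimes>\<^bsub>G\<^esub> h\<^sub>1 = \<one>\<^bsub>G\<^esub>" using G by (simp add: D3_generated_by_def)
  \<comment> \<open>\<open>hom\<close> records multiplicativity only; the value at the unit is
    computed as the square of the sign change.\<close>
  have "\<rho> \<one>\<^bsub>G\<^esub> = mat 1"
    using hom_mult[OF plane_action generators(1,1)] h
    by (simp add: orthogonal_group_def \<rho>_h1) (simp add: matrix_eq plane_rotation_pi flip: matrix_vector_mul_assoc)
  moreover have "\<sigma> \<one>\<^bsub>G\<^esub> = id"
    using index.id_eq_one by (auto simp: fun_eq_iff)
  moreover have "\<tau> \<one>\<^bsub>G\<^esub> (t rmod T) = t rmod T" for t
    using time.id_eq_one rmod_mem[of t] by (metis restrict_apply')
  ultimately show ?thesis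
    using periodic_fun_simple_rmod[OF assms T]
    by (intro ext) (simp add: loop_action_def config_action_def)
qed

text \<open>Multiplicativity of the action extends invariance from the two generators to the group
  they generate.\<close>

lemma act_fixed:
  assumes "odd_choreography T x" "g \<in> carrier G"
  shows "act g x = x"
proof -
  have p: "periodic_fun_simple x T" using assms(1) by (simp add: odd_choreography_def)
  have h: "act h\<^sub>1 x = x" "act h\<^sub>2 x = x"
    using assms(1) unfolding act_h1_iff[OF p] act_h2_iff[OF p] odd_choreography_iff by blast+
  have "g \<in> generate G {h\<^sub>1, h\<^sub>2}" using assms(2) generators by simp
  then show ?thesis
  proof (induction rule: generate.induct)
    case (eng a b)
    then show ?case using generators(5) act_mult[of a b x] by simp
  qed (use h act_one[OF p] generators in auto)
qed

lemma fixed_loops_iff: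
  "x \<in> fixed_loops T G \<tau> \<rho> \<sigma> \<longleftrightarrow> x \<in> loop_space T \<and> odd_choreography T x"
proof
  assume "x \<in> fixed_loops T G \<tau> \<rho> \<sigma>"
  then have x: "x \<in> loop_space T" "\<And>g. g \<in> carrier G \<Longrightarrow> act g x = x"
    by (auto simp: fixed_loops_def)
  have p: "periodic_fun_simple x T" using x(1) by (simp add: loop_space_def)
  then show "x \<in> loop_space T \<and> odd_choreography T x"
    using x(1) act_h1_iff[OF p] act_h2_iff[OF p] x(2)[OF generators(1)] x(2)[OF generators(2)]
    unfolding odd_choreography_iff by blast
next
  assume "x \<in> loop_space T \<and> odd_choreography T x"
  then show "x \<in> fixed_loops T G \<tau> \<rho> \<sigma>" by (auto simp: fixed_loops_def act_fixed)
qed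

end

section \<open>Choreographies and homographic motions\<close>

lemma odd_choreography_choreography:
  assumes "odd_choreography T x"
  shows "choreography T x"
  unfolding choreography_def
proof (intro conjI exI[of _ id] allI)
  show "periodic_fun_simple x T" by (rule odd_choreographyD(1)[OF assms])
  show "x t $ id (i + 1) = x (t + T / 3) $ id i" for i t
  proof -
    have "i = 1 \<and> i + 1 = 2 \<or> i = 2 \<and> i + 1 = 3 \<or> i = 3 \<and> i + 1 = 1"
      using exhaust_3[of i] by auto
    then show ?thesis using odd_choreography_shift[OF assms, of t] unfolding id_apply by metis
  qed
qed simp

lemma odd_choreography_not_homographic:
  assumes "odd_choreography T x" "collision_free x"
  shows "\<not> homographic x"
proof
  assume "homographic x"
  then obtain s where s: "\<And>t. to_complex (x t $ 3) = s t * to_complex (x 0 $ 3)"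
    unfolding homographic_def by blast
  have "x 0 $ 3 = 0" using odd_choreographyD(2)[OF assms(1), of 0] by (simp add: vec_eq_iff del: neg_equal_zero equal_neg_zero)
  then have "to_complex (x t $ 3) = 0" for t using s[of t] by (simp add: to_complex_def complex_eq_iff)
  then have "x t $ 3 = 0" for t by (simp add: to_complex_def vec_eq_iff forall_2 complex_eq_iff)
  then have "x 0 $ 1 = x 0 $ 2" using odd_choreographyD(3,4)[OF assms(1), of 0] by simp
  then show False using assms(2) by (auto simp: collision_free_def)
qed

subsection \<open>Existence of a minimizer\<close>

lemma period_measure_nn_integral:
  "(\<integral>\<^sup>+t\<in>{0..T}. f t \<partial>lborel) = (\<integral>\<^sup>+t. f t \<partial>period_measure T)"
  by (simp add: nn_integral_restrict_space)

definition pair_potential :: "configuration \<Rightarrow> ennreal" where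
  "pair_potential y = (\<Sum>(i, j)\<in>{(i, j). i < j}. 1 / ennreal (norm (y $ i - y $ j)))"

text \<open>Inversion is continuous on \<open>ennreal\<close>, with value infinity at 0. Collisions
  in a limit loop therefore need no separate treatment when Fatou's lemma is applied.\<close>

lemma continuous_on_pair_potential: "continuous_on UNIV pair_potential"
  unfolding pair_potential_def divide_ennreal_def split_beta mult_1
  by (intro continuous_intros continuous_on_inverse_ennreal continuous_on_ennreal)

lemma borel_measurable_pair_potential:
  assumes "continuous_on {0..T} x"
  shows "(\<lambda>t. pair_potential (x t)) \<in> borel_measurable (period_measure T)"
  using borel_measurable_period_measure[OF assms]
    borel_measurable_continuous_onI[OF continuous_on_pair_potential] by measurable

lemma norm_sq_cart: "(norm x)\<^sup>2 = (\<Sum>i\<in>UNIV. (norm (x $ i))\<^sup>2)" for x :: "'a::real_normed_vector ^ 'n"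
  by (simp add: norm_vec_def L2_set_def sum_nonneg)

lemma loop_spaceD:
  assumes "x \<in> loop_space T"
  shows "periodic_fun_simple x T" "continuous_on S x" "has_weak_derivative T x (weak_derivative T x)"
    "x t \<in> config_space"
proof -
  have "\<exists>v. has_weak_derivative T x v" using assms by (simp add: loop_space_def)
  then show "has_weak_derivative T x (weak_derivative T x)"
    unfolding weak_derivative_def by (rule someI_ex)
qed (use assms in \<open>auto simp: loop_space_def intro: continuous_on_subset\<close>)

lemma loop_spaceI:
  assumes "periodic_fun_simple x T" "continuous_on UNIV x" "\<And>t. x t \<in> config_space" "has_weak_derivative T x v"
  shows "x \<in> loop_space T"
  using assms unfolding loop_space_def by blast

text \<open>The action can be computed from any weak derivative, with kinetic part real and
  potential part extended.\<close>

lemma action_eq: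
  assumes T: "T > 0" and x: "x \<in> loop_space T" "has_weak_derivative T x v"
  shows "action T x = ennreal ((\<integral>t. (norm (v t))\<^sup>2 \<partial>period_measure T) / 2)
    + (\<integral>\<^sup>+t. pair_potential (x t) \<partial>period_measure T)"
proof -
  let ?M = "period_measure T"
  have sq: "integrable ?M (\<lambda>t. (norm (v t))\<^sup>2)"
    by (rule square_integrable_norm_sq[OF has_weak_derivative_square_integrable[OF x(2)]])
  note [measurable] = borel_measurable_pair_potential[OF loop_spaceD(2)[OF x(1)]]
  have [measurable]: "v \<in> borel_measurable ?M"
    using has_weak_derivative_integrable[OF x(2)] by auto
  have "AE t in ?M. weak_derivative T x t = v t"
    by (rule weak_derivative_unique[OF T loop_spaceD(2,3)[OF x(1)] x(2)])
  then have "action T x = (\<integral>\<^sup>+t. ennreal ((norm (v t))\<^sup>2 / 2) + pair_potential (x t) \<partial>?M)"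
    unfolding action_def period_measure_nn_integral pair_potential_def[symmetric] norm_sq_cart[of "v _"]
    by (intro nn_integral_cong_AE, eventually_elim) (simp add: sum_divide_distrib)
  also have "\<dots> = (\<integral>\<^sup>+t. ennreal ((norm (v t))\<^sup>2 / 2) \<partial>?M) + (\<integral>\<^sup>+t. pair_potential (x t) \<partial>?M)"
    by (rule nn_integral_add) measurable
  also have "(\<integral>\<^sup>+t. ennreal ((norm (v t))\<^sup>2 / 2) \<partial>?M) = ennreal ((\<integral>t. (norm (v t))\<^sup>2 \<partial>?M) / 2)"
    using sq by (subst nn_integral_eq_integral) auto
  finally show ?thesis .
qed

lemma config_space_closed: "closed config_space"
  unfolding config_space_def by (intro closed_Collect_eq continuous_intros)

text \<open>This is the coercivity: oddness puts body 3 at the origin at time 0, so its oscillation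
  bounds its position. The others are time shifts of it, and adding three bodies gives the factor
  3.\<close>

lemma odd_choreography_bound:
  assumes T: "T > 0" and x: "odd_choreography T x"
    and b: "\<And>s t. s \<in> {0..T} \<Longrightarrow> t \<in> {0..T} \<Longrightarrow> norm (x t - x s) \<le> B"
  shows "norm (x t) \<le> 3 * B"
proof -
  note o = odd_choreographyD[OF x]
  have x0: "x 0 $ 3 = 0" using o(2)[of 0] by (simp add: vec_eq_iff del: neg_equal_zero equal_neg_zero)
  have 3: "norm (x t $ 3) \<le> B" for t
  proof -
    have "t rmod T \<in> {0..T}" using rmod_less[OF T, of t] rmod_nonneg[of T t] T by auto
    then have "norm (x (t rmod T) - x 0) \<le> B" using T by (intro b) auto
    then have "norm (x t - x 0) \<le> B" by (simp add: periodic_fun_simple_rmod[OF o(1) T])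
    then have "norm ((x t - x 0) $ 3) \<le> B" by (rule order_trans[OF Finite_Cartesian_Product.norm_nth_le])
    then show ?thesis by (simp add: x0)
  qed
  have "norm (x t) \<le> (\<Sum>i\<in>UNIV. norm (x t $ i))"
    unfolding norm_vec_def by (rule L2_set_le_sum) simp
  also have "\<dots> \<le> 3 * B"
    using 3[of t] 3[of "t + T / 3"] 3[of "t + 2 * T / 3"] by (simp add: sum_3 o(3)[of t] o(4)[of t])
  finally show ?thesis .
qed

section \<open>The direct method\<close>

context eight_symmetry
begin

abbreviation symmetric_loops :: "loop set" where "symmetric_loops \<equiv> fixed_loops T G \<tau> \<rho> \<sigma>"

text \<open>Permanent total collision has infinite action, but it shows that the symmetric class is
  nonempty and serves as minimizer should the infimum be infinite.\<close>

lemma zero_fixed_loop: "(\<lambda>_. 0) \<in> symmetric_loops"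
proof -
  have "has_weak_derivative T (\<lambda>_. 0) (\<lambda>_. 0)"
    using T by (intro has_weak_derivative_C1) (auto intro!: periodic_fun_simple.intro)
  then have "(\<lambda>_. 0) \<in> loop_space T"
    by (rule loop_spaceI[rotated 3]) (auto simp: config_space_def intro!: periodic_fun_simple.intro)
  then show ?thesis
    by (auto simp: fixed_loops_iff odd_choreography_def intro!: periodic_fun_simple.intro)
qed

lemma minimizing_sequence_limit:
  fixes X :: "nat \<Rightarrow> loop"
  assumes X: "\<And>n. X n \<in> symmetric_loops" and bound: "\<And>n. action T (X n) \<le> ennreal B"
    and lim: "(\<lambda>n. action T (X n)) \<longlonglongrightarrow> m"
  shows "\<exists>x\<in>symmetric_loops. action T x \<le> m"
proof -
  let ?M = "period_measure T"
  define V where "V n = weak_derivative T (X n)" for n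
  define E where "E n = (\<integral>t. (norm (V n t))\<^sup>2 \<partial>?M)" for n
  define U where "U x = (\<integral>\<^sup>+t. pair_potential (x t) \<partial>?M)" for x
  have Xl: "X n \<in> loop_space T" and Xo: "odd_choreography T (X n)" for n
    using X[of n] by (auto simp: fixed_loops_iff)
  have V: "has_weak_derivative T (X n) (V n)" for n
    unfolding V_def by (rule loop_spaceD(3)[OF Xl])
  have A: "action T (X n) = ennreal (E n / 2) + U (X n)" for n
    unfolding E_def U_def by (rule action_eq[OF T Xl V])
  have E0: "E n \<ge> 0" for n unfolding E_def by (rule integral_norm_sq_nonneg)
  \<comment> \<open>The action contains half of \<open>E n\<close>, hence the factor 2; the absolute
    value covers negative \<open>B\<close>, for which \<open>ennreal B\<close> is 0.\<close>
  define E1 where "E1 = 2 * \<bar>B\<bar>"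
  have E1: "E n \<le> E1" for n
  proof -
    have "ennreal (E n / 2) \<le> ennreal (E n / 2) + U (X n)" by simp
    also have "\<dots> \<le> ennreal B" using A[of n] bound[of n] by simp
    also have "\<dots> \<le> ennreal \<bar>B\<bar>" by (intro ennreal_leI) simp
    finally show ?thesis by (simp add: E1_def)
  qed
  have E1_0: "E1 \<ge> 0" by (simp add: E1_def)
  have holder: "norm (X n t - X n s) \<le> (c * \<bar>t - s\<bar> + E1 / c) / 2"
    if "s \<in> {0..T}" "t \<in> {0..T}" "c > 0" for n s t c
    unfolding weak_derivative_primitive[OF T loop_spaceD(1,2)[OF Xl] V that(1,2)]
    using E1[of n] by (intro primitive_dist_le has_weak_derivative_square_integrable[OF V] that) (simp add: E_def)
  have bnd: "norm (X n t) \<le> 3 * ((T + E1) / 2)" for n t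
  proof (rule odd_choreography_bound[OF T Xo])
    fix s t assume st: "s \<in> {0..T}" "t \<in> {0..T}"
    then have "\<bar>t - s\<bar> \<le> T" by auto
    then show "norm (X n t - X n s) \<le> (T + E1) / 2"
      using holder[OF st, of 1 n] by simp
  qed
  have equi: "\<exists>d>0. \<forall>n t. t \<in> {0..T} \<and> norm (s - t) < d \<longrightarrow> norm (X n s - X n t) < e"
    if s: "s \<in> {0..T}" and e: "e > 0" for s e
  proof -
    define c where "c = (E1 + 1) / e"
    have c: "c > 0" using E1_0 e by (simp add: c_def)
    have "norm (X n s - X n t) < e" if "t \<in> {0..T}" "norm (s - t) < e / c" for n t
    proof -
      have "norm (X n s - X n t) \<le> (c * \<bar>s - t\<bar> + E1 / c) / 2"
        by (rule holder[OF that(1) s c])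
      also have "c * \<bar>s - t\<bar> < e" using that(2) c by (simp add: field_simps)
      also have "E1 / c \<le> e" using E1_0 e by (simp add: c_def field_simps)
      finally show ?thesis by simp
    qed
    then show ?thesis using e c by (intro exI[of _ "e / c"]) auto
  qed
  obtain g k where g: "continuous_on {0..T} g" "strict_mono (k :: nat \<Rightarrow> nat)"
    "\<And>e. 0 < e \<Longrightarrow> \<exists>N. \<forall>n t. n \<ge> N \<and> t \<in> {0..T} \<longrightarrow> norm (X (k n) t - g t) < e"
    by (rule Arzela_Ascoli[of "{0..T}" X "3 * ((T + E1) / 2)"]) (use bnd equi in auto)
  \<comment> \<open>Arzela-Ascoli gives a limit on one period only. The loops themselves are
    periodic, so the periodic extension is still a uniform limit, now on the whole line.\<close>
  define x where "x t = g (t rmod T)" for t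
  have unif: "\<exists>N. \<forall>n\<ge>N. \<forall>t. norm (X (k n) t - x t) < e" if e: "e > 0" for e
  proof -
    obtain N where N: "\<And>n t. n \<ge> N \<Longrightarrow> t \<in> {0..T} \<Longrightarrow> norm (X (k n) t - g t) < e"
      using g(3)[OF e] by blast
    have "norm (X (k n) t - x t) < e" if "n \<ge> N" for n t
      using N[OF that, of "t rmod T"] rmod_mem[of t] periodic_fun_simple_rmod[OF loop_spaceD(1)[OF Xl] T]
      by (simp add: x_def)
    then show ?thesis by blast
  qed
  have lim_x: "(\<lambda>n. X (k n) t) \<longlonglongrightarrow> x t" for t
    using unif unfolding LIMSEQ_iff by meson
  have "continuous_on UNIV x"
  proof (rule uniform_limit_theorem[of _ "\<lambda>n. X (k n)"])
    show "\<forall>\<^sub>F n in sequentially. continuous_on UNIV (X (k n))" using loop_spaceD(2)[OF Xl] by simp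
    show "uniform_limit UNIV (\<lambda>n. X (k n)) x sequentially"
      unfolding uniform_limit_sequentially_iff dist_norm using unif by simp
  qed simp
  have lim_c: "(\<lambda>n. X (k n) t $ i) \<longlonglongrightarrow> x t $ i" for t i
    by (intro tendsto_vec_nth lim_x)
  have xo: "odd_choreography T x"
    unfolding odd_choreography_def
  proof (intro conjI allI periodic_fun_simple.intro)
    note o = odd_choreographyD[OF Xo]
    show "x (t + T) = x t" for t
      using LIMSEQ_unique[OF lim_x[of "t + T"]] lim_x[of t] periodic_fun_simple.plus_period[OF o(1)] by simp
    show "x (- t) $ 3 = - x t $ 3" for t
      using LIMSEQ_unique[OF lim_c[of "- t" 3]] tendsto_minus[OF lim_c[of t 3]] o(2) by simp
    show "x t $ 1 = x (t + T / 3) $ 3" for t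
      using LIMSEQ_unique[OF lim_c[of t 1]] lim_c[of "t + T / 3" 3] o(3)[of _ t] by simp
    show "x t $ 2 = x (t + 2 * T / 3) $ 3" for t
      using LIMSEQ_unique[OF lim_c[of t 2]] lim_c[of "t + 2 * T / 3" 3] o(4)[of _ t] by simp
  qed
  have xc: "x t \<in> config_space" for t
    by (rule closed_sequentially[OF config_space_closed _ lim_x]) (rule loop_spaceD(4)[OF Xl])
  \<comment> \<open>Arzela-Ascoli controls positions, not velocities. A further subsequence makes
    the kinetic energies converge, as the lower semicontinuity result requires.\<close>
  have "compact {0..E1}" by simp
  then obtain e r where e: "e \<in> {0..E1}" "strict_mono (r :: nat \<Rightarrow> nat)" "((\<lambda>n. E (k n)) \<circ> r) \<longlonglongrightarrow> e"
    unfolding compact_def using E0 E1 by (metis atLeastAtMost_iff)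
  define Y where "Y n = X (k (r n))" for n
  have e_lim: "(\<lambda>n. E (k (r n))) \<longlonglongrightarrow> e" using e(3) by (simp add: o_def)
  have r_ge: "r n \<ge> n" for n using e(2) by (rule seq_suble)
  have xcont: "continuous_on S x" for S using \<open>continuous_on UNIV x\<close> continuous_on_subset by blast
  obtain w where w: "has_weak_derivative T x w" "(\<integral>t. (norm (w t))\<^sup>2 \<partial>?M) \<le> e"
  proof (rule weak_derivative_lower_semicontinuous[OF T xcont, of Y "\<lambda>n. V (k (r n))" e])
    show "\<exists>N. \<forall>n\<ge>N. \<forall>t\<in>{0..T}. norm (Y n t - x t) \<le> \<delta>" if "\<delta> > 0" for \<delta>
      using unif[OF that] r_ge unfolding Y_def by (meson less_imp_le order_trans)
  qed (use V loop_spaceD(2)[OF Xl] e_lim in \<open>auto simp: Y_def E_def\<close>)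
  have xl: "x \<in> loop_space T"
    using xo xc w(1) xcont by (intro loop_spaceI) (auto simp: odd_choreography_def)
  have "action T x \<le> m"
  proof (rule ennreal_le_epsilon)
    fix \<delta> :: real assume m: "m < top_class.top" and \<delta>: "0 < \<delta>"
    have Um: "(\<lambda>t. pair_potential (Y n t)) \<in> borel_measurable ?M" for n
      unfolding Y_def by (intro borel_measurable_pair_potential loop_spaceD(2)[OF Xl])
    \<comment> \<open>Spreading the limit kinetic term \<open>e / 2\<close> evenly over the period
      puts it under the integral, so a single use of Fatou's lemma treats kinetic and potential
      parts together.\<close>
    define c where "c = ennreal (e / (2 * T))"
    have const: "(\<integral>\<^sup>+t. c + pair_potential (y t) \<partial>?M) = ennreal (e / 2) + U y"
      if "(\<lambda>t. pair_potential (y t)) \<in> borel_measurable ?M" for y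
    proof -
      have "(\<integral>\<^sup>+t. c + pair_potential (y t) \<partial>?M) = (\<integral>\<^sup>+t. c \<partial>?M) + U y"
        unfolding U_def using that by (intro nn_integral_add) auto
      also have "(\<integral>\<^sup>+t. c \<partial>?M) = ennreal (e / 2)"
        using T e(1) by (simp add: c_def emeasure_restrict_space flip: ennreal_mult)
      finally show ?thesis .
    qed
    have "action T x \<le> ennreal (e / 2) + U x"
      unfolding action_eq[OF T xl w(1)] U_def[symmetric] using w(2) by (intro add_right_mono ennreal_leI) simp
    also have "\<dots> = (\<integral>\<^sup>+t. c + pair_potential (x t) \<partial>?M)"
      by (rule const[symmetric]) (intro borel_measurable_pair_potential xcont)
    also have "\<dots> = (\<integral>\<^sup>+t. liminf (\<lambda>n. c + pair_potential (Y n t)) \<partial>?M)"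
    proof (rule nn_integral_cong)
      fix t
      have "(\<lambda>n. Y n t) \<longlonglongrightarrow> x t"
        using LIMSEQ_subseq_LIMSEQ[OF lim_x e(2)] by (simp add: Y_def o_def)
      then have "(\<lambda>n. pair_potential (Y n t)) \<longlonglongrightarrow> pair_potential (x t)"
        by (rule continuous_on_tendsto_compose[OF continuous_on_pair_potential]) auto
      then have "(\<lambda>n. c + pair_potential (Y n t)) \<longlonglongrightarrow> c + pair_potential (x t)"
        by (intro tendsto_add tendsto_const)
      then show "c + pair_potential (x t) = liminf (\<lambda>n. c + pair_potential (Y n t))"
        by (intro lim_imp_Liminf[symmetric]) auto
    qed
    also have "\<dots> \<le> liminf (\<lambda>n. \<integral>\<^sup>+t. c + pair_potential (Y n t) \<partial>?M)"
      using Um by (intro nn_integral_liminf) auto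
    also have "\<dots> \<le> m + ennreal \<delta>"
    proof (rule Liminf_le)
      have "(\<lambda>n. action T (Y n)) \<longlonglongrightarrow> m"
        using LIMSEQ_subseq_LIMSEQ[OF LIMSEQ_subseq_LIMSEQ[OF lim g(2)] e(2)] by (simp add: Y_def o_def)
      moreover have "m < m + ennreal (\<delta> / 2)" using m \<delta> by (cases m) (auto simp flip: ennreal_plus simp: ennreal_less_iff)
      \<comment> \<open>The slack \<open>\<delta>\<close> is split: one half for the action to
        approach \<open>m\<close>, one half for replacing \<open>e / 2\<close> by the kinetic term
        of \<open>Y n\<close>.\<close>
      ultimately have "\<forall>\<^sub>F n in sequentially. action T (Y n) < m + ennreal (\<delta> / 2)"
        by (rule order_tendstoD(2))
      moreover have "\<forall>\<^sub>F n in sequentially. E (k (r n)) > e - \<delta>"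
        by (rule order_tendstoD(1)[OF e_lim]) (use \<delta> in simp)
      ultimately show "\<forall>\<^sub>F n in sequentially. (\<integral>\<^sup>+t. c + pair_potential (Y n t) \<partial>?M) \<le> m + ennreal \<delta>"
      proof eventually_elim
        case (elim n)
        have "(\<integral>\<^sup>+t. c + pair_potential (Y n t) \<partial>?M) = ennreal (e / 2) + U (Y n)" by (rule const[OF Um])
        also have "\<dots> \<le> ennreal (E (k (r n)) / 2 + \<delta> / 2) + U (Y n)"
          using elim(2) by (intro add_right_mono ennreal_leI) simp
        also have "\<dots> = action T (Y n) + ennreal (\<delta> / 2)"
          using E0 \<delta> by (simp add: Y_def A ac_simps)
        also have "\<dots> \<le> m + ennreal (\<delta> / 2) + ennreal (\<delta> / 2)"
          using elim(1) by (intro add_right_mono) simp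
        also have "\<dots> = m + ennreal \<delta>" using \<delta> by (simp add: add.assoc flip: ennreal_plus)
        finally show ?case .
      qed
    qed simp
    finally show "action T x \<le> m + ennreal \<delta>" .
  qed
  then show ?thesis using xl xo by (auto simp: fixed_loops_iff)
qed

lemma minimizer_exists: "\<exists>x. minimizer_on (action T) symmetric_loops x"
proof -
  define m where "m = Inf (action T ` symmetric_loops)"
  have m: "m \<le> action T y" if "y \<in> symmetric_loops" for y
    unfolding m_def using that by (intro Inf_lower) auto
  have "\<exists>x\<in>symmetric_loops. action T x \<le> m"
  proof (cases "m = top_class.top")
    case True
    then show ?thesis using zero_fixed_loop by (intro bexI[of _ "\<lambda>_. 0"]) auto
  next
    case False
    obtain f where f: "decseq f" "range f \<subseteq> action T ` symmetric_loops" "m = (INF i. f i)"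
      using ennreal_Inf_countable_INF[of "action T ` symmetric_loops"] zero_fixed_loop unfolding m_def by blast
    have "\<exists>X. \<forall>n. X n \<in> symmetric_loops \<and> f n = action T (X n)"
      using f(2) by (intro choice) blast
    then obtain X where X: "\<And>n. X n \<in> symmetric_loops" "\<And>n. f n = action T (X n)" by blast
    have lim: "f \<longlonglongrightarrow> m" unfolding f(3) by (rule LIMSEQ_INF[OF f(1)])
    have "\<forall>\<^sub>F n in sequentially. f n < top_class.top"
      using False by (intro order_tendstoD(2)[OF lim]) (simp add: less_top)
    then obtain N where N: "f N < top_class.top" by (auto simp: eventually_sequentially)
    \<comment> \<open>Dropping the first \<open>N\<close> terms leaves a decreasing sequence bounded
      by the finite value \<open>f N\<close>; this is the uniform action bound.\<close>
    show ?thesis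
    proof (rule minimizing_sequence_limit)
      show "X (n + N) \<in> symmetric_loops" for n by (rule X(1))
      show "action T (X (n + N)) \<le> ennreal (enn2real (f N))" for n
        using decseqD[OF f(1), of N "n + N"] N X(2)[of "n + N"] by simp
      show "(\<lambda>n. action T (X (n + N))) \<longlonglongrightarrow> m"
        using LIMSEQ_ignore_initial_segment[OF lim, of N] by (simp add: X(2))
    qed
  qed
  then show ?thesis unfolding minimizer_on_def using m by (meson order_trans)
qed

end

subsection \<open>Symmetric solutions of the linear equation\<close>

lemma has_vector_derivative_reflect:
  fixes f :: "real \<Rightarrow> 'a::real_normed_vector"
  assumes "(f has_vector_derivative d) (at (- t))"
  shows "((\<lambda>t. f (- t)) has_vector_derivative - d) (at t)"
proof -
  have "(uminus has_real_derivative -1) (at t)" by (auto intro!: derivative_eq_intros)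
  then have "(uminus has_vector_derivative -1) (at t)"
    by (simp add: has_real_derivative_iff_has_vector_derivative)
  from vector_diff_chain_at[OF this assms] show ?thesis by (simp add: o_def)
qed

text \<open>A vector is the sum of its components under the bounded linear embeddings
  \<open>axis i\<close>, so componentwise derivatives add up.\<close>

lemma has_vector_derivative_vec:
  fixes f :: "real \<Rightarrow> ('a::euclidean_space)^'n"
  assumes "\<And>i. ((\<lambda>t. f t $ i) has_vector_derivative f' $ i) (at t)"
  shows "(f has_vector_derivative f') (at t)"
proof -
  have lin: "bounded_linear (axis i :: 'a \<Rightarrow> 'a^'n)" for i
    unfolding linear_conv_bounded_linear[symmetric]
    by (rule linearI) (simp_all add: axis_def vec_eq_iff)
  have eq: "y = (\<Sum>i\<in>UNIV. axis i (y $ i))" for y :: "'a^'n"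
    by (simp add: vec_eq_iff axis_def if_distrib if_distribR cong: if_cong)
  have "((\<lambda>t. \<Sum>i\<in>UNIV. axis i (f t $ i)) has_vector_derivative (\<Sum>i\<in>UNIV. axis i (f' $ i))) (at t)"
    by (intro has_vector_derivative_sum bounded_linear.has_vector_derivative[OF lin] assms)
  then show ?thesis by (simp flip: eq)
qed

text \<open>An odd periodic function has mean zero, so its first antiderivative is periodic and
  even. The mean \<open>d\<close> of that one is removed before the second integration, which then
  gives a periodic odd function once it is normalized at 0.\<close>

lemma odd_periodic_double_antiderivative:
  fixes q :: "real \<Rightarrow> 'a::euclidean_space"
  assumes T: "T > 0" and q: "continuous_on UNIV q" "periodic_fun_simple q T" "\<And>t. q (- t) = - q t"
  obtains p p' where "\<And>t. (p has_vector_derivative p' t) (at t)" "\<And>t. (p' has_vector_derivative q t) (at t)"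
    "periodic_fun_simple p T" "periodic_fun_simple p' T" "\<And>t. p (- t) = - p t"
proof -
  obtain F c where F: "\<And>t. (F has_vector_derivative q t - c) (at t)" "periodic_fun_simple F T"
    by (rule periodic_antiderivative[OF T q(1,2)]) blast
  \<comment> \<open>This combination is constant and vanishes at 0. At \<open>T / 2\<close> the two
    values of \<open>F\<close> agree by periodicity, which forces the mean \<open>c\<close> to be 0;
    evenness of \<open>F\<close> follows.\<close>
  have "((\<lambda>t. F t - F (- t) + t *\<^sub>R (2 *\<^sub>R c)) has_vector_derivative 0) (at t)" for t
  proof -
    have "((\<lambda>t. F t - F (- t) + t *\<^sub>R (2 *\<^sub>R c)) has_vector_derivative (q t - c) - - (q (- t) - c) + 2 *\<^sub>R c) (at t)"
      by (intro has_vector_derivative_add has_vector_derivative_diff F has_vector_derivative_reflect)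
         (auto intro!: derivative_eq_intros)
    then show ?thesis by (simp add: q(3) scaleR_2)
  qed
  from has_vector_derivative_zero_const[OF this, of _ 0]
  have *: "F t - F (- t) + t *\<^sub>R (2 *\<^sub>R c) = 0" for t by simp
  have "F (T / 2) = F (- (T / 2))"
    using periodic_fun_simple.plus_period[OF F(2), of "- (T / 2)"] by (simp add: field_simps)
  with *[of "T / 2"] T have c: "c = 0" by simp
  have Feven: "F (- t) = F t" for t using *[of t] by (simp add: c)
  have Fq: "(F has_vector_derivative q t) (at t)" for t using F(1)[of t] by (simp add: c)
  have "continuous_on UNIV F"
    using Fq by (blast intro: continuous_at_imp_continuous_on has_vector_derivative_continuous)
  from periodic_antiderivative[OF T this F(2)]
  obtain P d where P: "\<And>t. (P has_vector_derivative F t - d) (at t)" "periodic_fun_simple P T" by blast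
  define p where "p t = P t - P 0" for t
  have p: "(p has_vector_derivative F t - d) (at t)" for t
    unfolding p_def using has_vector_derivative_diff[OF P(1) has_vector_derivative_const] by simp
  have "((\<lambda>t. p t + p (- t)) has_vector_derivative (F t - d) + - (F (- t) - d)) (at t)" for t
    by (intro has_vector_derivative_add p has_vector_derivative_reflect)
  then have "((\<lambda>t. p t + p (- t)) has_vector_derivative 0) (at t)" for t by (simp add: Feven)
  from has_vector_derivative_zero_const[OF this, of _ 0]
  have "p t + p (- t) = 0" for t by (simp add: p_def)
  then have "p (- t) = - p t" for t by (metis add_eq_0_iff)
  moreover have "((\<lambda>t. F t - d) has_vector_derivative q t) (at t)" for t
    using has_vector_derivative_diff[OF Fq has_vector_derivative_const] by simp
  moreover have "periodic_fun_simple p T" "periodic_fun_simple (\<lambda>t. F t - d) T"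
    using periodic_fun_simple.plus_period[OF P(2)] periodic_fun_simple.plus_period[OF F(2)]
    by (auto intro!: periodic_fun_simple.intro simp: p_def)
  ultimately show thesis using p by (intro that[of p "\<lambda>t. F t - d"]) auto
qed

text \<open>Only body 3 has to be solved for; the time lags of the symmetry define the other two, so
  the solution is symmetric by construction.\<close>

lemma odd_choreography_double_antiderivative:
  assumes T: "T > 0" and f: "continuous_on UNIV f" "odd_choreography T f" "\<And>t. f t \<in> config_space"
  obtains y y' where "\<And>t. (y has_vector_derivative y' t) (at t)" "\<And>t. (y' has_vector_derivative f t) (at t)"
    "periodic_fun_simple y' T" "odd_choreography T y" "\<And>t. y t \<in> config_space"
proof -
  note o = odd_choreographyD[OF f(2)]
  have "continuous_on UNIV (\<lambda>t. f t $ 3)" by (intro continuous_intros f)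
  moreover have "periodic_fun_simple (\<lambda>t. f t $ 3) T"
    using periodic_fun_simple.plus_period[OF o(1)] by (auto intro!: periodic_fun_simple.intro)
  ultimately obtain p p' where p: "\<And>t. (p has_vector_derivative p' t) (at t)"
    "\<And>t. (p' has_vector_derivative f t $ 3) (at t)"
    "periodic_fun_simple p T" "periodic_fun_simple p' T" "\<And>t. p (- t) = - p t"
    by (rule odd_periodic_double_antiderivative[OF T]) (use o(2) in auto)
  interpret p: periodic_fun_simple p T by (rule p(3))
  interpret p': periodic_fun_simple p' T by (rule p(4))
  define a where "a i = (if i = 1 then T / 3 else if i = 2 then 2 * T / 3 else 0)" for i :: 3
  have a: "a 1 = T / 3" "a 2 = 2 * T / 3" "a 3 = 0" by (simp_all add: a_def)
  define y y' where "y t = (\<chi> i. p (t + a i))" and "y' t = (\<chi> i. p' (t + a i))" for t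
  have fa: "f t $ i = f (t + a i) $ 3" for t i
    using exhaust_3[of i] o(3,4)[of t] by (auto simp: a)
  have y: "(y has_vector_derivative y' t) (at t)" for t
    by (rule has_vector_derivative_vec) (simp add: y_def y'_def has_vector_derivative_shift p(1))
  have y': "(y' has_vector_derivative f t) (at t)" for t
    by (rule has_vector_derivative_vec) (simp add: y'_def fa[of t] has_vector_derivative_shift p(2))
  have "p (t + T + a i) = p (t + a i)" "p' (t + T + a i) = p' (t + a i)" for t i
    using p.plus_period[of "t + a i"] p'.plus_period[of "t + a i"] by (simp_all add: ac_simps)
  then have per: "periodic_fun_simple y T" "periodic_fun_simple y' T"
    by (auto intro!: periodic_fun_simple.intro simp: y_def y'_def)
  have yo: "odd_choreography T y"
    using per(1) p(5) by (simp add: odd_choreography_def y_def a)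
  \<comment> \<open>Up to a factor, the center of mass. Its second derivative is zero, so it is
    affine in time; periodicity removes the slope, and at time 0 the contributions of bodies 1 and 2
    cancel by oddness.\<close>
  define S where "S t = y t $ 1 + y t $ 2 + y t $ 3" for t
  define S' where "S' t = y' t $ 1 + y' t $ 2 + y' t $ 3" for t
  have comp: "((\<lambda>t. g t $ i) has_vector_derivative d $ i) (at t)"
    if "(g has_vector_derivative d) (at t)" for g :: loop and d t i
    by (rule bounded_linear.has_vector_derivative[OF bounded_linear_vec_nth that])
  have S: "(S has_vector_derivative S' t) (at t)" for t
    unfolding S_def S'_def by (intro has_vector_derivative_add comp y)
  have S'': "(S' has_vector_derivative f t $ 1 + f t $ 2 + f t $ 3) (at t)" for t
    unfolding S'_def by (intro has_vector_derivative_add comp y')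
  have "(S' has_vector_derivative 0) (at t)" for t
    using S''[of t] f(3)[of t] by (simp add: config_space_def)
  from has_vector_derivative_zero_const[OF this, of _ 0] have S'0: "S' t = S' 0" for t .
  have Sd: "((\<lambda>t. S t - t *\<^sub>R S' 0) has_vector_derivative S' t - S' 0) (at t)" for t
    by (intro has_vector_derivative_diff S) (auto intro!: derivative_eq_intros)
  have "((\<lambda>t. S t - t *\<^sub>R S' 0) has_vector_derivative 0) (at t)" for t
    using Sd[of t] unfolding S'0[of t] by simp
  from has_vector_derivative_zero_const[OF this] have S_eq: "S t - t *\<^sub>R S' 0 = S 0 - 0 *\<^sub>R S' 0" for t .
  have S_lin: "S t = S 0 + t *\<^sub>R S' 0" for t
    using S_eq[of t] by (simp add: diff_eq_eq)
  have "S T = S 0" using periodic_fun_simple.plus_period[OF per(1), of 0] by (simp add: S_def)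
  then have "S' 0 = 0" using S_lin[of T] T by simp
  have "S 0 = p (T / 3) + p (2 * T / 3)"
    using p(5)[of 0] by (simp add: S_def y_def a vec_eq_iff del: neg_equal_zero equal_neg_zero)
  also have "p (2 * T / 3) = - p (T / 3)"
    using p.plus_period[of "- (T / 3)"] p(5)[of "T / 3"] by (simp add: field_simps)
  finally have "S t = 0" for t using S_lin[of t] \<open>S' 0 = 0\<close> by simp
  then have "y t \<in> config_space" for t by (simp add: config_space_def S_def)
  with y y' per(2) yo show thesis by (rule that)
qed

subsection \<open>The Newtonian force\<close>

definition force :: "configuration \<Rightarrow> configuration" where
  "force y = (\<chi> i. \<Sum>j\<in>UNIV - {i}. (1 / norm (y $ j - y $ i) ^ 3) *\<^sub>R (y $ j - y $ i))"

lemma force_components: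
  "force y $ 1 = (1 / norm (y $ 2 - y $ 1) ^ 3) *\<^sub>R (y $ 2 - y $ 1) + (1 / norm (y $ 3 - y $ 1) ^ 3) *\<^sub>R (y $ 3 - y $ 1)"
  "force y $ 2 = (1 / norm (y $ 1 - y $ 2) ^ 3) *\<^sub>R (y $ 1 - y $ 2) + (1 / norm (y $ 3 - y $ 2) ^ 3) *\<^sub>R (y $ 3 - y $ 2)"
  "force y $ 3 = (1 / norm (y $ 1 - y $ 3) ^ 3) *\<^sub>R (y $ 1 - y $ 3) + (1 / norm (y $ 2 - y $ 3) ^ 3) *\<^sub>R (y $ 2 - y $ 3)"
proof -
  have ne: "(1::3) \<noteq> 2" "(1::3) \<noteq> 3" "(2::3) \<noteq> 3" by simp_all
  have "UNIV - {1::3} = {2, 3}" "UNIV - {2::3} = {1, 3}" "UNIV - {3::3} = {1, 2}"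
    unfolding UNIV_3 by (use ne ne[symmetric] in blast)+
  then show
  "force y $ 1 = (1 / norm (y $ 2 - y $ 1) ^ 3) *\<^sub>R (y $ 2 - y $ 1) + (1 / norm (y $ 3 - y $ 1) ^ 3) *\<^sub>R (y $ 3 - y $ 1)"
  "force y $ 2 = (1 / norm (y $ 1 - y $ 2) ^ 3) *\<^sub>R (y $ 1 - y $ 2) + (1 / norm (y $ 3 - y $ 2) ^ 3) *\<^sub>R (y $ 3 - y $ 2)"
  "force y $ 3 = (1 / norm (y $ 1 - y $ 3) ^ 3) *\<^sub>R (y $ 1 - y $ 3) + (1 / norm (y $ 2 - y $ 3) ^ 3) *\<^sub>R (y $ 2 - y $ 3)"
    by (simp_all add: force_def)
qed

text \<open>Action and reaction cancel in pairs.\<close>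

lemma force_config_space: "force y \<in> config_space"
  by (simp add: config_space_def force_components norm_minus_commute[of "y $ 2" "y $ 1"]
      norm_minus_commute[of "y $ 3" "y $ 1"] norm_minus_commute[of "y $ 3" "y $ 2"] algebra_simps)

text \<open>The force is odd in the configuration and commutes with relabeling of the equal masses.
  This keeps the equation \<open>y'' = F(x)\<close> inside the symmetric class.\<close>

lemma odd_choreography_force:
  assumes x: "odd_choreography T x"
  shows "odd_choreography T (\<lambda>t. force (x t))"
  unfolding odd_choreography_def
proof (intro conjI allI)
  note o = odd_choreographyD[OF x]
  show "periodic_fun_simple (\<lambda>t. force (x t)) T"
    using periodic_fun_simple.plus_period[OF o(1)] by (auto intro!: periodic_fun_simple.intro)
  have r: "x t $ i = - x (- t) $ Transposition.transpose 1 2 i" for t i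
    using x unfolding odd_choreography_iff by blast
  have "x (- t) $ 1 = - x t $ 2" "x (- t) $ 2 = - x t $ 1" for t
    using r[of "- t" 1] r[of "- t" 2] by (simp_all add: Transposition.transpose_def)
  then show "force (x (- t)) $ 3 = - force (x t) $ 3" for t
    by (simp add: force_components o(2)[of t] norm_minus_commute[of "x t $ 3"] algebra_simps)
  have s: "force (x (t + T / 3)) $ 3 = force (x t) $ 1" "force (x (t + T / 3)) $ 1 = force (x t) $ 2" for t
    using odd_choreography_shift[OF x, of t] by (simp_all add: force_components)
  show "force (x t) $ 1 = force (x (t + T / 3)) $ 3" for t using s by simp
  have "t + T / 3 + T / 3 = t + 2 * T / 3" for t by simp
  then show "force (x t) $ 2 = force (x (t + 2 * T / 3)) $ 3" for t
    using s(1)[of "t + T / 3"] s(2)[of t] by metis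
qed

lemma continuous_on_force:
  assumes "continuous_on S x" "\<And>t i j. t \<in> S \<Longrightarrow> i \<noteq> j \<Longrightarrow> x t $ i \<noteq> x t $ j"
  shows "continuous_on S (\<lambda>t. force (x t))"
  unfolding force_def using assms(2) by (intro continuous_intros assms(1)) auto

text \<open>In the order of the index type, \<open>3\<close> is the same as \<open>0\<close> and
  hence the least element.\<close>

lemma index_pairs: "{(i, j). i < j} = {(3, 1), (3, 2), (1, 2 :: 3)}"
proof -
  have "(3::3) < 1" "(3::3) < 2" "(1::3) < 2"
    unfolding less_bit1_def bit1.Rep_numeral bit1.Rep_1 by simp_all
  note lt = this
  have "i < j \<longleftrightarrow> i = 3 \<and> j = 1 \<or> i = 3 \<and> j = 2 \<or> i = 1 \<and> j = 2" for i j :: 3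
  proof -
    consider "i = 1" | "i = 2" | "i = 3" using exhaust_3 by blast
    moreover consider "j = 1" | "j = 2" | "j = 3" using exhaust_3 by blast
    ultimately show ?thesis
      by (metis lt less_irrefl less_asym)
  qed
  then show ?thesis by blast
qed

text \<open>The force is the gradient of the potential; grouping its terms by pairs gives the
  directional derivative as a sum over relative positions.\<close>

lemma force_inner:
  "force y \<bullet> \<phi> = - (\<Sum>(i, j)\<in>{(i, j). i < j}. ((y $ i - y $ j) \<bullet> (\<phi> $ i - \<phi> $ j)) / norm (y $ i - y $ j) ^ 3)"
  unfolding index_pairs
  by (simp add: inner_vec_def[of "force y"] sum_3 force_components norm_minus_commute[of "y $ 2" "y $ 1"]
      norm_minus_commute[of "y $ 1" "y $ 3"] norm_minus_commute[of "y $ 2" "y $ 3"]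
      inner_add inner_diff add_divide_distrib diff_divide_distrib)

section \<open>Second-order expansion of the potential\<close>

definition real_potential :: "configuration \<Rightarrow> real" where
  "real_potential y = (\<Sum>(i, j)\<in>{(i, j). i < j}. 1 / norm (y $ i - y $ j))"

text \<open>At a collision the two sides would differ: the real quotient \<open>1 / 0\<close> is 0,
  the extended one infinite.\<close>

lemma pair_potential_real:
  assumes "\<And>i j. i \<noteq> j \<Longrightarrow> y $ i \<noteq> y $ j"
  shows "pair_potential y = ennreal (real_potential y)"
proof -
  have "1 / ennreal (norm (y $ i - y $ j)) = ennreal (1 / norm (y $ i - y $ j))" if "i \<noteq> j" for i j
    using divide_ennreal[of 1 "norm (y $ i - y $ j)"] assms[OF that] by simp
  then show ?thesis
    unfolding pair_potential_def real_potential_def index_pairs by simp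
qed

text \<open>A one-sided Taylor bound with explicit remainder. With \<open>r\<close> the ratio of the
  norms, \<open>s = r\<^sup>2 - 1\<close> is polynomial in the inner products, and
  \<open>1 / r\<close> is bounded by a quadratic in \<open>s\<close>. Since \<open>s\<close> is at
  most \<open>5/2\<close> times \<open>norm e / norm d\<close>, the remainder constant is
  \<open>2 * 25/4\<close>, rounded up to 13.\<close>

lemma inverse_norm_expansion:
  fixes d e :: "'a::real_inner"
  assumes m: "0 < m" "m \<le> norm d" and e: "norm e \<le> norm d / 2"
  shows "1 / norm (d - e) \<le> 1 / norm d + (d \<bullet> e) / norm d ^ 3 + 13 * (norm e)\<^sup>2 / m ^ 3"
proof -
  define a where "a = norm d"
  define r where "r = norm (d - e) / a"
  define s where "s = r\<^sup>2 - 1"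
  have a: "a > 0" "m \<le> a" using m by (auto simp: a_def)
  have "norm (d - e) \<ge> norm d - norm e" by (rule norm_triangle_ineq2)
  then have r: "r \<ge> 1/2" using e a(1) by (simp add: r_def a_def field_simps)
  have key: "1 / r \<le> 1 - s / 2 + 2 * s\<^sup>2"
  proof -
    \<comment> \<open>Twice \<open>r\<close> times the desired difference factors with a double root
      at \<open>r = 1\<close>, the point of tangency; the cofactor is nonnegative once
      \<open>r\<close> is at least \<open>1/2\<close>.\<close>
    have "0 \<le> (r - 1)\<^sup>2 * (4 * r * (r + 1)\<^sup>2 - (r + 2))"
    proof (intro mult_nonneg_nonneg)
      have "4 * r * (r + 1)\<^sup>2 \<ge> 4 * r * (9/4)"
        using r power_mono[of "3/2" "r + 1" 2] by (intro mult_left_mono) (auto simp: power_divide)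
      then show "0 \<le> 4 * r * (r + 1)\<^sup>2 - (r + 2)" using r by linarith
    qed simp
    also have "\<dots> = 2 * r * (1 - s / 2 + 2 * s\<^sup>2) - 2"
      unfolding s_def by (simp add: power2_eq_square field_simps)
    finally show ?thesis using r by (simp add: field_simps)
  qed
  have s: "s = ((norm e)\<^sup>2 - 2 * (d \<bullet> e)) / a\<^sup>2"
    using a(1) unfolding s_def r_def
    by (simp add: power_divide power2_norm_eq_inner inner_diff inner_commute field_simps a_def)
  have "\<bar>s\<bar> \<le> (5 / 2) * norm e / a"
  proof -
    have "\<bar>(norm e)\<^sup>2 - 2 * (d \<bullet> e)\<bar> \<le> (norm e)\<^sup>2 + 2 * (a * norm e)"
      using Cauchy_Schwarz_ineq2[of d e] unfolding a_def
      by (smt (verit) zero_le_power2)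
    also have "(norm e)\<^sup>2 \<le> (a / 2) * norm e"
      unfolding power2_eq_square a_def using e by (intro mult_right_mono) auto
    finally have "\<bar>(norm e)\<^sup>2 - 2 * (d \<bullet> e)\<bar> \<le> (5 / 2) * a * norm e" by simp
    then show ?thesis using a(1) by (simp add: s abs_div field_simps power2_eq_square)
  qed
  then have "s\<^sup>2 \<le> ((5 / 2) * norm e / a)\<^sup>2"
    by (metis abs_ge_zero power2_abs power_mono)
  also have "((5 / 2) * norm e / a)\<^sup>2 = 25 / 4 * ((norm e)\<^sup>2 / a\<^sup>2)"
    by (simp add: power_divide power_mult_distrib)
  finally have "s\<^sup>2 \<le> 25 / 4 * ((norm e)\<^sup>2 / a\<^sup>2)" .
  moreover have "0 \<le> (norm e)\<^sup>2 / a\<^sup>2" by simp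
  ultimately have "2 * s\<^sup>2 \<le> 13 * ((norm e)\<^sup>2 / a\<^sup>2)" by linarith
  then have s2: "2 * s\<^sup>2 \<le> 13 * (norm e)\<^sup>2 / a\<^sup>2" by simp
  have "- s / 2 \<le> (d \<bullet> e) / a\<^sup>2"
    using a(1) by (simp add: s field_simps)
  with key s2 have "1 / r \<le> 1 + (d \<bullet> e) / a\<^sup>2 + 13 * (norm e)\<^sup>2 / a\<^sup>2" by linarith
  then have "(1 / r) / a \<le> (1 + (d \<bullet> e) / a\<^sup>2 + 13 * (norm e)\<^sup>2 / a\<^sup>2) / a"
    using a(1) by (intro divide_right_mono) auto
  also have "\<dots> = 1 / a + (d \<bullet> e) / a ^ 3 + 13 * (norm e)\<^sup>2 / a ^ 3"
    using a(1) by (simp add: field_simps power2_eq_square power3_eq_cube)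
  also have "13 * (norm e)\<^sup>2 / a ^ 3 \<le> 13 * (norm e)\<^sup>2 / m ^ 3"
    using m a by (intro divide_left_mono power_mono mult_pos_pos) auto
  also have "(1 / r) / a = 1 / norm (d - e)" using a(1) by (simp add: r_def)
  finally show ?thesis by (simp add: a_def)
qed

subsection \<open>The first variation\<close>

lemma real_potential_nonneg: "real_potential y \<ge> 0"
  unfolding real_potential_def by (intro sum_nonneg) auto

text \<open>A relative displacement is at most \<open>2 * M * \<epsilon>\<close>, so the smallness
  condition keeps it within half of every mutual distance. Its square turns 13 into 52 per pair, and
  three pairs give 156. The remainder is uniform over configurations with the same \<open>m\<close>
  and \<open>M\<close>, so it survives integration over time.\<close>

lemma real_potential_variation:
  assumes m: "0 < m" "\<And>i j. i \<noteq> j \<Longrightarrow> m \<le> norm (y $ i - y $ j)"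
    and M: "norm \<phi> \<le> M" and \<epsilon>: "0 < \<epsilon>" "4 * \<epsilon> * M \<le> m"
  shows "pair_potential (y - \<epsilon> *\<^sub>R \<phi>) = ennreal (real_potential (y - \<epsilon> *\<^sub>R \<phi>))"
    "real_potential (y - \<epsilon> *\<^sub>R \<phi>) \<le> real_potential y - \<epsilon> * (force y \<bullet> \<phi>) + 156 * M\<^sup>2 / m ^ 3 * \<epsilon>\<^sup>2"
proof -
  define d where "d i j = y $ i - y $ j" for i j
  define e where "e i j = \<epsilon> *\<^sub>R (\<phi> $ i - \<phi> $ j)" for i j
  have de: "(y - \<epsilon> *\<^sub>R \<phi>) $ i - (y - \<epsilon> *\<^sub>R \<phi>) $ j = d i j - e i j" for i j
    by (simp add: d_def e_def algebra_simps)
  have e_le: "norm (e i j) \<le> \<epsilon> * (2 * M)" for i j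
  proof -
    have "norm (\<phi> $ i - \<phi> $ j) \<le> norm (\<phi> $ i) + norm (\<phi> $ j)" by (rule norm_triangle_ineq4)
    also have "\<dots> \<le> 2 * M"
      using Finite_Cartesian_Product.norm_nth_le[of \<phi> i] Finite_Cartesian_Product.norm_nth_le[of \<phi> j] M by linarith
    finally show ?thesis using \<epsilon>(1) by (simp add: e_def)
  qed
  have half: "norm (e i j) \<le> norm (d i j) / 2" if "i \<noteq> j" for i j
    using e_le[of i j] m(2)[OF that] \<epsilon>(2) unfolding d_def by linarith
  show "pair_potential (y - \<epsilon> *\<^sub>R \<phi>) = ennreal (real_potential (y - \<epsilon> *\<^sub>R \<phi>))"
  proof (rule pair_potential_real)
    fix i j :: 3 assume ij: "i \<noteq> j"
    have "norm (e i j) < norm (d i j)" using half[OF ij] m(1) m(2)[OF ij] unfolding d_def by linarith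
    then have "d i j - e i j \<noteq> 0" by auto
    then show "(y - \<epsilon> *\<^sub>R \<phi>) $ i \<noteq> (y - \<epsilon> *\<^sub>R \<phi>) $ j" using de[of i j] by auto
  qed
  have "real_potential (y - \<epsilon> *\<^sub>R \<phi>) = (\<Sum>(i, j)\<in>{(i, j). i < j}. 1 / norm (d i j - e i j))"
    unfolding real_potential_def de ..
  also have "\<dots> \<le> (\<Sum>(i, j)\<in>{(i, j). i < j}. 1 / norm (d i j) + \<epsilon> * ((d i j \<bullet> (\<phi> $ i - \<phi> $ j)) / norm (d i j) ^ 3)
      + 52 * M\<^sup>2 / m ^ 3 * \<epsilon>\<^sup>2)"
  proof (rule sum_mono, clarify)
    fix i j :: 3 assume "i < j"
    then have ij: "i \<noteq> j" by auto
    have "1 / norm (d i j - e i j) \<le> 1 / norm (d i j) + (d i j \<bullet> e i j) / norm (d i j) ^ 3 + 13 * (norm (e i j))\<^sup>2 / m ^ 3"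
      using m(2)[OF ij] by (intro inverse_norm_expansion m(1) half[OF ij]) (simp add: d_def)
    also have "13 * (norm (e i j))\<^sup>2 / m ^ 3 \<le> 13 * (\<epsilon> * (2 * M))\<^sup>2 / m ^ 3"
      using e_le[of i j] m(1) by (intro divide_right_mono mult_left_mono power_mono) auto
    also have "\<dots> = 52 * M\<^sup>2 / m ^ 3 * \<epsilon>\<^sup>2" by (simp add: power_mult_distrib)
    also have "(d i j \<bullet> e i j) / norm (d i j) ^ 3 = \<epsilon> * ((d i j \<bullet> (\<phi> $ i - \<phi> $ j)) / norm (d i j) ^ 3)"
      by (simp add: e_def)
    finally show "1 / norm (d i j - e i j) \<le> 1 / norm (d i j)
      + \<epsilon> * ((d i j \<bullet> (\<phi> $ i - \<phi> $ j)) / norm (d i j) ^ 3) + 52 * M\<^sup>2 / m ^ 3 * \<epsilon>\<^sup>2" by simp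
  qed
  also have "\<dots> = real_potential y + \<epsilon> * (- (force y \<bullet> \<phi>)) + 3 * (52 * M\<^sup>2 / m ^ 3 * \<epsilon>\<^sup>2)"
    unfolding force_inner real_potential_def index_pairs d_def by (simp add: ring_distribs)
  finally show "real_potential (y - \<epsilon> *\<^sub>R \<phi>) \<le> real_potential y - \<epsilon> * (force y \<bullet> \<phi>) + 156 * M\<^sup>2 / m ^ 3 * \<epsilon>\<^sup>2"
    by simp
qed

text \<open>Compactness of a period: the smallest mutual distance is continuous and positive, so it
  attains a positive minimum.\<close>

lemma collision_free_distance:
  assumes x: "continuous_on {0..T} x" "collision_free x" "T \<ge> 0"
  obtains m where "m > 0" "\<And>t i j. t \<in> {0..T} \<Longrightarrow> i \<noteq> j \<Longrightarrow> m \<le> norm (x t $ i - x t $ j)"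
proof -
  define \<mu> where "\<mu> t = min (norm (x t $ 1 - x t $ 2)) (min (norm (x t $ 1 - x t $ 3)) (norm (x t $ 2 - x t $ 3)))" for t
  have "continuous_on {0..T} \<mu>" unfolding \<mu>_def by (intro continuous_intros x)
  then have "\<exists>t0\<in>{0..T}. \<forall>t\<in>{0..T}. \<mu> t0 \<le> \<mu> t"
    using x(3) by (intro continuous_attains_inf) auto
  then obtain t0 where t0: "\<And>t. t \<in> {0..T} \<Longrightarrow> \<mu> t0 \<le> \<mu> t" by blast
  show thesis
  proof (rule that[of "\<mu> t0"])
    show "\<mu> t0 > 0" using x(2) by (simp add: \<mu>_def collision_free_def)
    fix t and i j :: 3 assume t: "t \<in> {0..T}" and ij: "i \<noteq> j"
    have "\<mu> t \<le> norm (x t $ i - x t $ j)"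
      using exhaust_3[of i] exhaust_3[of j] ij
      by (elim disjE) (simp_all add: \<mu>_def norm_minus_commute[of "x t $ 2" "x t $ 1"]
        norm_minus_commute[of "x t $ 3" "x t $ 1"] norm_minus_commute[of "x t $ 3" "x t $ 2"])
    then show "\<mu> t0 \<le> norm (x t $ i - x t $ j)" using t0[OF t] by linarith
  qed
qed

lemma odd_choreography_linear:
  assumes x: "odd_choreography T x" and y: "odd_choreography T y"
  shows "odd_choreography T (\<lambda>t. x t + c *\<^sub>R y t)"
  using periodic_fun_simple.plus_period[OF odd_choreographyD(1)[OF x]]
    periodic_fun_simple.plus_period[OF odd_choreographyD(1)[OF y]]
    odd_choreographyD(2)[OF x] odd_choreographyD(2)[OF y]
  by (auto simp: odd_choreography_def odd_choreographyD(3,4)[OF x, symmetric] odd_choreographyD(3,4)[OF y, symmetric]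
      intro!: periodic_fun_simple.intro)

lemma loop_space_linear:
  assumes x: "x \<in> loop_space T" and y: "y \<in> loop_space T"
  shows "(\<lambda>t. x t + c *\<^sub>R y t) \<in> loop_space T"
proof (rule loop_spaceI)
  show "has_weak_derivative T (\<lambda>t. x t + c *\<^sub>R y t) (\<lambda>t. 1 *\<^sub>R weak_derivative T x t + c *\<^sub>R weak_derivative T y t)"
    using has_weak_derivative_linear[OF loop_spaceD(2,3)[OF x] loop_spaceD(2,3)[OF y], of 1 c] by simp
  show "periodic_fun_simple (\<lambda>t. x t + c *\<^sub>R y t) T"
    using periodic_fun_simple.plus_period[OF loop_spaceD(1)[OF x]]
      periodic_fun_simple.plus_period[OF loop_spaceD(1)[OF y]]
    by (auto intro!: periodic_fun_simple.intro)
  show "continuous_on UNIV (\<lambda>t. x t + c *\<^sub>R y t)"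
    by (intro continuous_intros loop_spaceD(2)[OF x] loop_spaceD(2)[OF y])
  fix t
  have eq: "(x t + c *\<^sub>R y t) $ 1 + (x t + c *\<^sub>R y t) $ 2 + (x t + c *\<^sub>R y t) $ 3
      = (x t $ 1 + x t $ 2 + x t $ 3) + c *\<^sub>R (y t $ 1 + y t $ 2 + y t $ 3)"
    by (simp add: algebra_simps)
  have "x t $ 1 + x t $ 2 + x t $ 3 = 0" "y t $ 1 + y t $ 2 + y t $ 3 = 0"
    using loop_spaceD(4)[OF x, of t] loop_spaceD(4)[OF y, of t] by (simp_all add: config_space_def)
  then show "x t + c *\<^sub>R y t \<in> config_space"
    unfolding config_space_def mem_Collect_eq eq by simp
qed

lemma integral_norm_sq_diff_scaleR:
  assumes "square_integrable M v" "square_integrable M w"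
  shows "(\<integral>x. (norm (v x + (- c) *\<^sub>R w x))\<^sup>2 \<partial>M)
    = (\<integral>x. (norm (v x))\<^sup>2 \<partial>M) - 2 * c * (\<integral>x. v x \<bullet> w x \<partial>M) + c\<^sup>2 * (\<integral>x. (norm (w x))\<^sup>2 \<partial>M)"
proof -
  have eq: "(norm (a + (- c) *\<^sub>R b))\<^sup>2 = (norm a)\<^sup>2 - 2 * c * (a \<bullet> b) + c\<^sup>2 * (norm b)\<^sup>2" for a b :: 'b
    unfolding power2_norm_eq_inner by (simp add: inner_add inner_diff inner_commute power2_eq_square algebra_simps)
  show ?thesis unfolding eq
    using square_integrable_norm_sq[OF assms(1)] square_integrable_norm_sq[OF assms(2)] square_integrable_inner[OF assms]
    by simp
qed

context eight_symmetry
begin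

text \<open>Comparison with \<open>x - \<epsilon> \<phi>\<close> for small positive
  \<open>\<epsilon>\<close>. The linear terms cannot exceed the quadratic remainder, and division by
  \<open>\<epsilon>\<close> leaves the inequality in the limit. This one-sided form suffices when
  the left side is itself a squared norm.\<close>

lemma minimizer_first_variation:
  assumes min: "minimizer_on (action T) symmetric_loops x" and cf: "collision_free x"
    and v: "has_weak_derivative T x v" and \<phi>: "\<phi> \<in> symmetric_loops" "has_weak_derivative T \<phi> \<phi>'"
  shows "(\<integral>t. v t \<bullet> \<phi>' t \<partial>period_measure T) + (\<integral>t. force (x t) \<bullet> \<phi> t \<partial>period_measure T) \<le> 0"
proof -
  let ?M = "period_measure T"
  interpret M: finite_measure ?M by (rule finite_measure_period_measure)
  have xl: "x \<in> loop_space T" "odd_choreography T x" and \<phi>l: "\<phi> \<in> loop_space T" "odd_choreography T \<phi>"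
    using min \<phi>(1) by (auto simp: minimizer_on_def fixed_loops_iff)
  note xc = loop_spaceD(2)[OF xl(1)] and \<phi>c = loop_spaceD(2)[OF \<phi>l(1)]
  note sq = has_weak_derivative_square_integrable[OF v] has_weak_derivative_square_integrable[OF \<phi>(2)]
  obtain m where m: "m > 0" "\<And>t i j. t \<in> {0..T} \<Longrightarrow> i \<noteq> j \<Longrightarrow> m \<le> norm (x t $ i - x t $ j)"
    by (rule collision_free_distance[OF xc[of "{0..T}"] cf]) (use T in auto)
  have "bounded (\<phi> ` {0..T})"
    by (intro compact_imp_bounded compact_continuous_image \<phi>c) simp
  then obtain M where M: "M > 0" "\<And>t. t \<in> {0..T} \<Longrightarrow> norm (\<phi> t) \<le> M"
    unfolding bounded_pos by auto
  define K where "K = 156 * M\<^sup>2 / m ^ 3"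
  define N where "N w = (\<integral>t. (norm (w t))\<^sup>2 \<partial>?M)" for w :: loop
  define D where "D = (\<integral>t. v t \<bullet> \<phi>' t \<partial>?M) + (\<integral>t. force (x t) \<bullet> \<phi> t \<partial>?M)"
  have Fc: "continuous_on {0..T} (\<lambda>t. force (x t))"
    using cf by (intro continuous_on_force xc) (auto simp: collision_free_def)
  have F\<phi>: "integrable ?M (\<lambda>t. force (x t) \<bullet> \<phi> t)"
    by (intro integrable_period_measure continuous_intros Fc \<phi>c)
  have Rc: "integrable ?M (\<lambda>t. real_potential (x t))"
    unfolding real_potential_def index_pairs using cf
    by (intro integrable_period_measure) (auto simp: collision_free_def intro!: continuous_intros xc)
  have N0: "N w \<ge> 0" for w unfolding N_def by (rule integral_norm_sq_nonneg)
  \<comment> \<open>The bound on \<open>\<epsilon>\<close> is the smallness condition of the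
    pointwise expansion. Of the error terms, \<open>N \<phi>' / 2\<close> comes from the kinetic
    energy and \<open>K * T\<close> from integrating the remainder of the potential.\<close>
  have bound: "D \<le> \<epsilon> * (N \<phi>' / 2 + K * T)" if \<epsilon>: "0 < \<epsilon>" "\<epsilon> \<le> m / (4 * M)" for \<epsilon>
  proof -
    define z where "z t = x t + (- \<epsilon>) *\<^sub>R \<phi> t" for t
    have small: "4 * \<epsilon> * M \<le> m" using \<epsilon> M(1) by (simp add: field_simps)
    have zl: "z \<in> loop_space T" unfolding z_def by (rule loop_space_linear[OF xl(1) \<phi>l(1)])
    have "odd_choreography T z" unfolding z_def by (rule odd_choreography_linear[OF xl(2) \<phi>l(2)])
    with zl have le_xz: "action T x \<le> action T z"
      using min by (auto simp: minimizer_on_def fixed_loops_iff)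
    \<comment> \<open>Absence of collisions makes the action of \<open>x\<close> finite, so the
      comparison can leave \<open>ennreal\<close>.\<close>
    have act_x: "action T x = ennreal (N v / 2 + (\<integral>t. real_potential (x t) \<partial>?M))"
    proof -
      have "pair_potential (x t) = ennreal (real_potential (x t))" for t
        using cf by (intro pair_potential_real) (auto simp: collision_free_def)
      then have "(\<integral>\<^sup>+t. pair_potential (x t) \<partial>?M) = ennreal (\<integral>t. real_potential (x t) \<partial>?M)"
        using Rc by (simp add: nn_integral_eq_integral real_potential_nonneg)
      then show ?thesis
        unfolding action_eq[OF T xl(1) v] N_def
        by (subst ennreal_plus) (auto intro!: integral_nonneg_AE simp: real_potential_nonneg)
    qed
    \<comment> \<open>The integral of the pointwise majorant \<open>b\<close> of the varied
      potential; an upper bound for the action of \<open>z\<close> is enough.\<close>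
    define B where
      "B = (\<integral>t. real_potential (x t) \<partial>?M) - \<epsilon> * (\<integral>t. force (x t) \<bullet> \<phi> t \<partial>?M) + K * \<epsilon>\<^sup>2 * T"
    have act_z: "action T z \<le> ennreal (N (\<lambda>t. v t + (- \<epsilon>) *\<^sub>R \<phi>' t) / 2 + B)" and B0: "0 \<le> B"
    proof -
      define b where "b t = real_potential (x t) - \<epsilon> * (force (x t) \<bullet> \<phi> t) + K * \<epsilon>\<^sup>2" for t
      have z_eq: "z t = x t - \<epsilon> *\<^sub>R \<phi> t" for t by (simp add: z_def)
      have pp: "pair_potential (z t) = ennreal (real_potential (z t))" "real_potential (z t) \<le> b t" if "t \<in> {0..T}" for t
        using real_potential_variation[OF m(1) m(2)[OF that] M(2)[OF that] \<epsilon>(1) small]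
        unfolding z_eq b_def K_def by auto
      have b0: "0 \<le> b t" if "t \<in> {0..T}" for t
        using pp(2)[OF that] real_potential_nonneg[of "z t"] by linarith
      have bi: "integrable ?M b"
        unfolding b_def
        by (intro Bochner_Integration.integrable_add Bochner_Integration.integrable_diff integrable_mult_right
            Rc F\<phi> finite_measure.integrable_const finite_measure_period_measure)
      have "has_weak_derivative T z (\<lambda>t. v t + (- \<epsilon>) *\<^sub>R \<phi>' t)"
        using has_weak_derivative_linear[OF xc v \<phi>c \<phi>(2), of 1 "- \<epsilon>"] unfolding z_def by simp
      then have "action T z = ennreal (N (\<lambda>t. v t + (- \<epsilon>) *\<^sub>R \<phi>' t) / 2) + (\<integral>\<^sup>+t. pair_potential (z t) \<partial>?M)"
        unfolding N_def by (rule action_eq[OF T zl])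
      also have "(\<integral>\<^sup>+t. pair_potential (z t) \<partial>?M) \<le> (\<integral>\<^sup>+t. ennreal (b t) \<partial>?M)"
        using pp by (intro nn_integral_mono) (auto intro!: ennreal_leI)
      also have "(\<integral>\<^sup>+t. ennreal (b t) \<partial>?M) = ennreal (\<integral>t. b t \<partial>?M)"
        using b0 by (intro nn_integral_eq_integral bi) (auto intro!: AE_I2)
      finally have le: "action T z \<le> ennreal (N (\<lambda>t. v t + (- \<epsilon>) *\<^sub>R \<phi>' t) / 2) + ennreal (\<integral>t. b t \<partial>?M)"
        by (simp add: add_left_mono)
      have b_int: "(\<integral>t. b t \<partial>?M) = B"
        unfolding b_def B_def using Rc F\<phi> T by (simp add: measure_period_measure)
      have "0 \<le> (\<integral>t. b t \<partial>?M)" using b0 by (intro integral_nonneg_AE AE_I2) auto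
      then show "0 \<le> B" by (simp add: b_int)
      then show "action T z \<le> ennreal (N (\<lambda>t. v t + (- \<epsilon>) *\<^sub>R \<phi>' t) / 2 + B)"
        using le N0 by (subst ennreal_plus) (simp_all add: b_int)
    qed
    have "ennreal (N v / 2 + (\<integral>t. real_potential (x t) \<partial>?M)) \<le>
      ennreal (N (\<lambda>t. v t + (- \<epsilon>) *\<^sub>R \<phi>' t) / 2 + B)"
      using order_trans[OF le_xz act_z] unfolding act_x .
    then have "N v / 2 + (\<integral>t. real_potential (x t) \<partial>?M) \<le> N (\<lambda>t. v t + (- \<epsilon>) *\<^sub>R \<phi>' t) / 2 + B"
      using N0[of "\<lambda>t. v t + (- \<epsilon>) *\<^sub>R \<phi>' t"] B0 by (subst (asm) ennreal_le_iff) (rule add_nonneg_nonneg, simp)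
    also have "N (\<lambda>t. v t + (- \<epsilon>) *\<^sub>R \<phi>' t) = N v - 2 * \<epsilon> * (\<integral>t. v t \<bullet> \<phi>' t \<partial>?M) + \<epsilon>\<^sup>2 * N \<phi>'"
      unfolding N_def by (rule integral_norm_sq_diff_scaleR[OF sq])
    finally have "\<epsilon> * D \<le> \<epsilon> * (\<epsilon> * (N \<phi>' / 2 + K * T))"
      unfolding D_def B_def by (simp add: power2_eq_square add_divide_distrib diff_divide_distrib algebra_simps)
    then show ?thesis using \<epsilon>(1) by simp
  qed
  have "((\<lambda>\<epsilon>. \<epsilon> * (N \<phi>' / 2 + K * T)) \<longlongrightarrow> 0 * (N \<phi>' / 2 + K * T)) (at_right 0)"
    by (intro tendsto_intros)
  then have "D \<le> 0 * (N \<phi>' / 2 + K * T)"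
  proof (rule tendsto_lowerbound)
    have "\<forall>\<^sub>F \<epsilon> in at_right 0. \<epsilon> < m / (4 * M)"
      using m(1) M(1) by (intro order_tendstoD(2)[OF tendsto_ident_at]) auto
    then show "\<forall>\<^sub>F \<epsilon> in at_right 0. D \<le> \<epsilon> * (N \<phi>' / 2 + K * T)"
      using eventually_at_right_less[of 0] by eventually_elim (use bound in auto)
  qed simp
  then show ?thesis by (simp add: D_def)
qed

text \<open>The single variation \<open>x - y\<close> replaces both the principle of symmetric criticality and the
  regularity theory.\<close>

lemma minimizer_newton_solution:
  assumes min: "minimizer_on (action T) symmetric_loops x" and cf: "collision_free x"
  shows "newton_solution x"
proof -
  let ?M = "period_measure T"
  have xl: "x \<in> loop_space T" and xo: "odd_choreography T x"
    using min by (auto simp: minimizer_on_def fixed_loops_iff)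
  define v where "v = weak_derivative T x"
  have v: "has_weak_derivative T x v" unfolding v_def by (rule loop_spaceD(3)[OF xl])
  have Fc: "continuous_on UNIV (\<lambda>t. force (x t))"
    using cf by (intro continuous_on_force loop_spaceD(2)[OF xl]) (auto simp: collision_free_def)
  obtain y y' where y: "\<And>t. (y has_vector_derivative y' t) (at t)"
    "\<And>t. (y' has_vector_derivative force (x t)) (at t)"
    "periodic_fun_simple y' T" "odd_choreography T y" "\<And>t. y t \<in> config_space"
    by (rule odd_choreography_double_antiderivative[OF T Fc odd_choreography_force[OF xo] force_config_space]) blast
  have yc: "continuous_on S y" "continuous_on S y'" for S
    using y(1,2) by (blast intro: continuous_at_imp_continuous_on has_vector_derivative_continuous)+
  have yw: "has_weak_derivative T y y'"
    using T by (intro has_weak_derivative_C1 odd_choreographyD(1)[OF y(4)] y(1) yc) auto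
  have yl: "y \<in> loop_space T"
    by (rule loop_spaceI[OF odd_choreographyD(1)[OF y(4)] yc(1) y(5) yw])
  define \<phi> \<phi>' where "\<phi> t = x t + (- 1) *\<^sub>R y t" and "\<phi>' t = v t - y' t" for t
  have \<phi>l: "\<phi> \<in> loop_space T" unfolding \<phi>_def by (rule loop_space_linear[OF xl yl])
  have \<phi>: "\<phi> \<in> symmetric_loops"
    using \<phi>l odd_choreography_linear[OF xo y(4), of "-1"] by (simp add: fixed_loops_iff \<phi>_def[abs_def])
  have \<phi>w: "has_weak_derivative T \<phi> \<phi>'"
    using has_weak_derivative_diff[OF loop_spaceD(2)[OF xl] v yc(1) yw] by (simp add: \<phi>_def[abs_def] \<phi>'_def[abs_def])
  note sq = has_weak_derivative_square_integrable[OF v] has_weak_derivative_square_integrable[OF yw]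
    has_weak_derivative_square_integrable[OF \<phi>w]
  \<comment> \<open>Since \<open>y'\<close> is an antiderivative of the force, integration by parts
    turns the force term into the cross term that completes the square of
    \<open>v - y'\<close>.\<close>
  have "(\<integral>t. force (x t) \<bullet> \<phi> t \<partial>?M) = - (\<integral>t. y' t \<bullet> \<phi>' t \<partial>?M)"
    by (rule weak_integration_by_parts[OF loop_spaceD(2)[OF \<phi>l] \<phi>w y(3,2) Fc])
  then have "(\<integral>t. v t \<bullet> \<phi>' t \<partial>?M) - (\<integral>t. y' t \<bullet> \<phi>' t \<partial>?M) \<le> 0"
    using minimizer_first_variation[OF min cf v \<phi> \<phi>w] by simp
  also have "(\<integral>t. v t \<bullet> \<phi>' t \<partial>?M) - (\<integral>t. y' t \<bullet> \<phi>' t \<partial>?M) = (\<integral>t. v t \<bullet> \<phi>' t - y' t \<bullet> \<phi>' t \<partial>?M)"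
    using square_integrable_inner[OF sq(1,3)] square_integrable_inner[OF sq(2,3)] by simp
  also have "\<dots> = (\<integral>t. (norm (\<phi>' t))\<^sup>2 \<partial>?M)"
    by (simp add: power2_norm_eq_inner \<phi>'_def inner_diff_left)
  finally have zero: "(\<integral>t. (norm (\<phi>' t))\<^sup>2 \<partial>?M) \<le> 0" .
  have const: "\<phi> t = \<phi> 0" if t: "t \<in> {0..T}" for t
  proof (rule ccontr)
    assume ne: "\<phi> t \<noteq> \<phi> 0"
    define b where "b = norm (\<phi> t - \<phi> 0)"
    have b: "b > 0" using ne by (simp add: b_def)
    have 0: "0 \<in> {0..T}" using T by simp
    have "b = norm (primitive T \<phi>' t - primitive T \<phi>' 0)"
      unfolding b_def weak_derivative_primitive[OF T loop_spaceD(1,2)[OF \<phi>l] \<phi>w 0 t] ..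
    \<comment> \<open>With zero energy the Young estimate holds for every weight;
      \<open>b / T\<close> yields the contradiction \<open>b \<le> b / 2\<close> over a whole
      period.\<close>
    also have "\<dots> \<le> (b / T * \<bar>t - 0\<bar> + 0 / (b / T)) / 2"
      using b T by (intro primitive_dist_le[OF sq(3) zero 0 t]) simp
    also have "\<dots> \<le> b / 2" using t T b by (simp add: field_simps)
    finally show False using b by simp
  qed
  have "x t = y t + \<phi> 0" for t
  proof -
    have "\<phi> t = \<phi> (t rmod T)" by (rule periodic_fun_simple_rmod[OF loop_spaceD(1)[OF \<phi>l] T, symmetric])
    also have "\<dots> = \<phi> 0" using rmod_mem[of t] by (intro const) auto
    finally have "\<phi> t = \<phi> 0" .
    moreover have "x t = y t + \<phi> t" by (simp add: \<phi>_def)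
    ultimately show ?thesis by simp
  qed
  then have x_eq: "x = (\<lambda>t. y t + \<phi> 0)" by auto
  \<comment> \<open>Differing from \<open>y\<close> by a constant, \<open>x\<close> inherits
    classical derivatives; \<open>y'\<close> is the velocity that witnesses Newton's
    equation.\<close>
  have "(x has_vector_derivative y' t) (at t)" for t
    unfolding x_eq using has_vector_derivative_add[OF y(1) has_vector_derivative_const] by simp
  moreover have "((\<lambda>s. y' s $ i) has_vector_derivative force (x t) $ i) (at t)" for t i
    by (rule bounded_linear.has_vector_derivative[OF bounded_linear_vec_nth y(2)])
  ultimately show ?thesis
    unfolding newton_solution_def by (intro exI[of _ y']) (simp add: force_def)
qed

end

theorem mainTheorem6:
  fixes T :: real
    and G :: "('g, 'm) monoid_scheme"
    and h\<^sub>1 h\<^sub>2 :: 'g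
    and \<tau> :: "'g \<Rightarrow> real \<Rightarrow> real"
    and \<rho> :: "'g \<Rightarrow> real^2^2"
    and \<sigma> :: "'g \<Rightarrow> 3 \<Rightarrow> 3"
  assumes T: "T > 0"
    and G: "D3_generated_by G h\<^sub>1 h\<^sub>2"
    and time_action: "group_action G {0..<T} \<tau>"
    and plane_action: "\<rho> \<in> hom G orthogonal_group"
    and index_action: "group_action G UNIV \<sigma>"
    and \<tau>_h1: "\<forall>t\<in>{0..<T}. \<tau> h\<^sub>1 t = (- t) rmod T"
    and \<tau>_h2: "\<forall>t\<in>{0..<T}. \<tau> h\<^sub>2 t = (T / 3 - t) rmod T"
    and \<rho>_h1: "\<rho> h\<^sub>1 = plane_rotation pi"
    and \<rho>_h2: "\<rho> h\<^sub>2 = plane_rotation pi"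
    and \<sigma>_h1: "\<sigma> h\<^sub>1 = Transposition.transpose 1 2"
    and \<sigma>_h2: "\<sigma> h\<^sub>2 = Transposition.transpose 2 3"
    and local_minima_collision_free:
      "\<forall>x. H1_local_minimizer_on T (action T) (fixed_loops T G \<tau> \<rho> \<sigma>) x \<longrightarrow> collision_free x"
  shows "(\<exists>x. minimizer_on (action T) (fixed_loops T G \<tau> \<rho> \<sigma>) x) \<and>
    (\<forall>x. minimizer_on (action T) (fixed_loops T G \<tau> \<rho> \<sigma>) x \<longrightarrow>
       collision_free x \<and> periodic_fun_simple x T \<and> newton_solution x \<and>
       choreography T x \<and>
       \<not> homographic x \<and> \<not> euler_solution x \<and> \<not> lagrange_solution x)"
proof -
  interpret eight_symmetry T G h\<^sub>1 h\<^sub>2 \<tau> \<rho> \<sigma>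
    by (rule eight_symmetry.intro; fact)
  show ?thesis
  proof (intro conjI minimizer_exists allI impI)
    fix x assume min: "minimizer_on (action T) symmetric_loops x"
    then have xo: "odd_choreography T x" by (auto simp: minimizer_on_def fixed_loops_iff)
    \<comment> \<open>A global minimizer is a local one with any radius, so the assumption applies
      to it.\<close>
    have "H1_local_minimizer_on T (action T) symmetric_loops x"
      using min unfolding H1_local_minimizer_on_def minimizer_on_def by (auto intro: exI[of _ 1])
    then show cf: "collision_free x" using local_minima_collision_free by blast
    show "periodic_fun_simple x T" by (rule odd_choreographyD(1)[OF xo])
    show "newton_solution x" by (rule minimizer_newton_solution[OF min cf])
    show "choreography T x" by (rule odd_choreography_choreography[OF xo])
    show nh: "\<not> homographic x" by (rule odd_choreography_not_homographic[OF xo cf])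
    show "\<not> euler_solution x" "\<not> lagrange_solution x"
      using nh by (auto simp: euler_solution_def lagrange_solution_def)
  qed
qed

end
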